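(* Let $(x_0,t_0)\in\mathbb{R}\times\mathbb{R}^+$ with $u(x_0+,t_0)<u(x_0-,t_0)$. (i) Let $x=x(t)$, $t\ge t_0$, be the forward generalized characteristic $X(x_0,t_0)$. Then $$\lim_{\substack{(x,t)\to(x_0,t_0)\\(x,t)\in\Delta^-(x_0,t_0)}}u(x\pm,t)=u(x_0-,t_0),\qquad\lim_{\substack{(x,t)\to(x_0,t_0)\\(x,t)\in\Delta^+(x_0,t_0)}}u(x\pm,t)=u(x_0+,t_0),$$ $$\lim_{t\to t_0+}u(x(t)-,t)=u(x_0-,t_0),\qquad\lim_{t\to t_0+}u(x(t)+,t)=u(x_0+,t_0).$$ (ii) If there exists a component $J_n=(c_n,d_n)\ne\varnothing$ of $\mathcal{U}^c(x_0,t_0)$, then $$\lim_{\substack{(x,t)\to(x_0,t_0)\\(x,t)\in\Delta^-_{J_n}(x_0,t_0)}}u(x\pm,t)=d_n,\qquad\lim_{\substack{(x,t)\to(x_0,t_0)\\(x,t)\in\Delta^+_{J_n}(x_0,t_0)}}u(x\pm,t)=c_n,$$ $$\lim_{t\to t_0-}u(x_n(t)-,t)=d_n,\qquad\lim_{t\to t_0-}u(x_n(t)+,t)=c_n,$$ where $x=x_n(t)$, $t\ge t_n$, is the forward generalized characteristic of any point $(x_n,t_n)\in\Delta_{J_n}(x_0,t_0)$.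
   Context: Setting: $f\in C^2(\mathbb{R})$, $f''\ge0$, $\mathcal{L}\{f''=0\}=0$, so $f'$ is strictly increasing; $\varphi\in L^\infty(\mathbb{R})$. For $t>0$: $E(u;x,t)=t\int_0^u f''(s)(\varphi(x-tf'(s))-s)\,ds$; $\mathcal{U}(x,t)$ is the (nonempty compact) set of maximizers of $E(\cdot\,;x,t)$. The entropy solution of $u_t+f(u)_x=0$, $u|_{t=0}=\varphi$ is $u(x,t)=\inf\mathcal{U}(x,t)$, with traces $u(x-,t)=\sup\mathcal{U}(x,t)$, $u(x+,t)=\inf\mathcal{U}(x,t)$. For $t_0>0$: $I=[u(x_0+,t_0),u(x_0-,t_0)]$, $\mathcal{U}^c(x_0,t_0)=I\setminus\mathcal{U}(x_0,t_0)=\bigcup_nJ_n$ with $J_n=(c_n,d_n)$ the component open intervals; $l_u(x_0,t_0)=\{(x,t): x=x_0+(t-t_0)f'(u),\ t\in(0,t_0)\}$; $\Delta_G(x_0,t_0)=\bigcup_{u\in G}l_u(x_0,t_0)$ for $G\subset\mathbb{R}$. Forward generalized characteristic $X(x_0,t_0)$: the unique curve $x=x(t)$, $t\ge t_0$, $x(t_0)=x_0$, with $\Delta_I(x_0,t_0)\subset\Delta_I(x(t_1),t_1)\subset\Delta_I(x(t_2),t_2)$ for all $t_2>t_1>t_0$ (it exists, is unique and continuous). With $l^\pm(t)=x_0+(t-t_0)f'(u(x_0\pm,t_0))$ for $t\in(0,t_0)$: $\Delta^-(x_0,t_0)=\{(x,t): x<x(t)\text{ if }t\ge t_0,\ x<l^-(t)\text{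 if }t\in(0,t_0)\}$, $\Delta^+(x_0,t_0)=\{(x,t): x>x(t)\text{ if }t\ge t_0,\ x>l^+(t)\text{ if }t\in(0,t_0)\}$. For $(x_n,t_n)\in\Delta_{J_n}(x_0,t_0)$, its forward generalized characteristic $x_n(t)$ passes through $(x_0,t_0)$ and there is $\hat t_n\in(t_n,t_0)$ with $u(x_n(t)+,t)<u(x_n(t)-,t)$ for $t\in[\hat t_n,t_0]$; with such a $\hat t_n$, $\Delta^\mp_{J_n}(x_0,t_0)=\{(x,t)\in\Delta_{J_n}(x_0,t_0): t\in(\hat t_n,t_0),\ x<x_n(t)\ (\text{resp. }x>x_n(t))\}$. *)

theory Defs
  imports "HOL-Analysis.Analysis"
begin

definition C2 :: "(real \<Rightarrow> real) \<Rightarrow> bool" where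
  "C2 f \<longleftrightarrow> (\<forall>u. f field_differentiable (at u)) \<and>
           (\<forall>u. deriv f field_differentiable (at u)) \<and>
           continuous_on UNIV (deriv (deriv f))"

definition Linfty :: "(real \<Rightarrow> real) \<Rightarrow> bool" where
  "Linfty \<phi> \<longleftrightarrow> \<phi> \<in> borel_measurable lebesgue \<and> (\<exists>M. AE x in lebesgue. \<bar>\<phi> x\<bar> \<le> M)"

text \<open>
  The integral is oriented: for \<open>u < 0\<close> it is minus the integral over \<open>(u, 0)\<close>.
  Changing \<open>\<phi>\<close> on a null set does not change \<open>Efun\<close> in the setting of interest
  (\<open>f'' \<ge> 0\<close>), because of the weight \<open>f''(s)\<close>.
\<close>

definition Efun :: "(real \<Rightarrow> real) \<Rightarrow> (real \<Rightarrow> real) \<Rightarrow> real \<Rightarrow> real \<Rightarrow> real \<Rightarrow> real" where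
  "Efun f \<phi> u x t =
     t * interval_lebesgue_integral lebesgue 0 (ereal u)
           (\<lambda>s. deriv (deriv f) s * (\<phi> (x - t * deriv f s) - s))"

definition Umax :: "(real \<Rightarrow> real) \<Rightarrow> (real \<Rightarrow> real) \<Rightarrow> real \<Rightarrow> real \<Rightarrow> real set" where
  "Umax f \<phi> x t = {u. \<forall>v. Efun f \<phi> v x t \<le> Efun f \<phi> u x t}"

text \<open>
  The entropy solution of \<open>u\<^sub>t + f(u)\<^sub>x = 0\<close> with initial datum \<open>\<phi>\<close>, given by the
  solution formula, for \<open>t > 0\<close>.
\<close>

definition usol :: "(real \<Rightarrow> real) \<Rightarrow> (real \<Rightarrow> real) \<Rightarrow> real \<Rightarrow> real \<Rightarrow> real" where
  "usol f \<phi> x t = Inf (Umax f \<phi> x t)"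

text \<open>
  The traces \<open>u(x-,t)\<close> and \<open>u(x+,t)\<close> are the one-sided spatial limits. In the setting
  of interest they exist and equal \<open>Sup (Umax f \<phi> x t)\<close> and \<open>Inf (Umax f \<phi> x t)\<close>.
\<close>

definition uleft :: "(real \<Rightarrow> real) \<Rightarrow> (real \<Rightarrow> real) \<Rightarrow> real \<Rightarrow> real \<Rightarrow> real" where
  "uleft f \<phi> x t = Lim (at_left x) (\<lambda>y. usol f \<phi> y t)"

definition uright :: "(real \<Rightarrow> real) \<Rightarrow> (real \<Rightarrow> real) \<Rightarrow> real \<Rightarrow> real \<Rightarrow> real" where
  "uright f \<phi> x t = Lim (at_right x) (\<lambda>y. usol f \<phi> y t)"

definition Iset :: "(real \<Rightarrow> real) \<Rightarrow> (real \<Rightarrow> real) \<Rightarrow> real \<Rightarrow> real \<Rightarrow> real set" where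
  "Iset f \<phi> x t = {uright f \<phi> x t .. uleft f \<phi> x t}"

definition Ucompl :: "(real \<Rightarrow> real) \<Rightarrow> (real \<Rightarrow> real) \<Rightarrow> real \<Rightarrow> real \<Rightarrow> real set" where
  "Ucompl f \<phi> x t = Iset f \<phi> x t - Umax f \<phi> x t"

text \<open>Points of the plane are pairs \<open>(x, t)\<close>: space first, then time.\<close>

definition lseg :: "(real \<Rightarrow> real) \<Rightarrow> real \<Rightarrow> real \<Rightarrow> real \<Rightarrow> (real \<times> real) set" where
  "lseg f x0 t0 u = {(x, t). x = x0 + (t - t0) * deriv f u \<and> 0 < t \<and> t < t0}"

definition Delta :: "(real \<Rightarrow> real) \<Rightarrow> real set \<Rightarrow> real \<Rightarrow> real \<Rightarrow> (real \<times> real) set" where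
  "Delta f G x0 t0 = (\<Union>u\<in>G. lseg f x0 t0 u)"

text \<open>
  \<open>fwd_char f \<phi> x0 t0 X\<close>: the curve \<open>x = X t\<close>, \<open>t \<ge> t0\<close>, is the forward generalized
  characteristic of \<open>(x0, t0)\<close>. The values of \<open>X\<close> at times before \<open>t0\<close> are irrelevant.
\<close>

definition fwd_char ::
  "(real \<Rightarrow> real) \<Rightarrow> (real \<Rightarrow> real) \<Rightarrow> real \<Rightarrow> real \<Rightarrow> (real \<Rightarrow> real) \<Rightarrow> bool" where
  "fwd_char f \<phi> x0 t0 X \<longleftrightarrow> X t0 = x0 \<and>
     (\<forall>t1 t2. t0 < t1 \<and> t1 < t2 \<longrightarrow>
        Delta f (Iset f \<phi> x0 t0) x0 t0 \<subseteq> Delta f (Iset f \<phi> (X t1) t1) (X t1) t1 \<and>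
        Delta f (Iset f \<phi> (X t1) t1) (X t1) t1 \<subseteq> Delta f (Iset f \<phi> (X t2) t2) (X t2) t2)"

definition Delta_minus ::
  "(real \<Rightarrow> real) \<Rightarrow> (real \<Rightarrow> real) \<Rightarrow> real \<Rightarrow> real \<Rightarrow> (real \<Rightarrow> real) \<Rightarrow> (real \<times> real) set" where
  "Delta_minus f \<phi> x0 t0 X =
     {(x, t). (t0 \<le> t \<and> x < X t) \<or>
              (0 < t \<and> t < t0 \<and> x < x0 + (t - t0) * deriv f (uleft f \<phi> x0 t0))}"

definition Delta_plus ::
  "(real \<Rightarrow> real) \<Rightarrow> (real \<Rightarrow> real) \<Rightarrow> real \<Rightarrow> real \<Rightarrow> (real \<Rightarrow> real) \<Rightarrow> (real \<times> real) set" where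
  "Delta_plus f \<phi> x0 t0 X =
     {(x, t). (t0 \<le> t \<and> X t < x) \<or>
              (0 < t \<and> t < t0 \<and> x0 + (t - t0) * deriv f (uright f \<phi> x0 t0) < x)}"

text \<open>
  The parts of the open triangle \<open>Delta f J x0 t0\<close> after time \<open>th\<close> to the left and to
  the right of a curve \<open>Y\<close> in it, where \<open>Y\<close> is the forward generalized characteristic of
  a point of the triangle and is a shock on \<open>[th, t0]\<close>.
\<close>

definition Delta_J_minus ::
  "(real \<Rightarrow> real) \<Rightarrow> real set \<Rightarrow> real \<Rightarrow> real \<Rightarrow> real \<Rightarrow> (real \<Rightarrow> real) \<Rightarrow> (real \<times> real) set" where
  "Delta_J_minus f J x0 t0 th Y = {(x, t) \<in> Delta f J x0 t0. th < t \<and> t < t0 \<and> x < Y t}"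

definition Delta_J_plus ::
  "(real \<Rightarrow> real) \<Rightarrow> real set \<Rightarrow> real \<Rightarrow> real \<Rightarrow> real \<Rightarrow> (real \<Rightarrow> real) \<Rightarrow> (real \<times> real) set" where
  "Delta_J_plus f J x0 t0 th Y = {(x, t) \<in> Delta f J x0 t0. th < t \<and> t < t0 \<and> Y t < x}"

definition shock_from ::
  "(real \<Rightarrow> real) \<Rightarrow> (real \<Rightarrow> real) \<Rightarrow> (real \<Rightarrow> real) \<Rightarrow> real \<Rightarrow> real \<Rightarrow> bool" where
  "shock_from f \<phi> Y th t0 \<longleftrightarrow> (\<forall>t\<in>{th..t0}. uright f \<phi> (Y t) t < uleft f \<phi> (Y t) t)"

end

theory Submission
  imports Defs
begin

text \<open>
  Substituting \<open>y = x - t f'(s)\<close> turns the maximization of \<open>E\<close> into the Hopf--Lax problem of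
  minimizing \<open>\<Phi>(x - t f'(u)) + t h(u)\<close> with \<open>\<Phi>\<close> a Lipschitz primitive of \<open>\<phi>\<close> and
  \<open>h(u) = u f'(u) - f(u)\<close>. Strict convexity makes the minimizer unique in the interior of every
  backward characteristic, so backward characteristics of different points do not cross and their
  base points \<open>x - t f'(u)\<close> at time \<open>0\<close> are ordered. Since the set of minimizers is bounded with
  closed graph, every limit value at \<open>(x\<^sub>0, t\<^sub>0)\<close> is a minimizer there, and the order of the base
  points singles out the required one. In part (ii) this requires that the curve carries a shock
  before \<open>t\<^sub>0\<close>: otherwise it would be a straight line whose slope belongs to a minimizer in
  \<open>(c\<^sub>n, d\<^sub>n)\<close>.
\<close>

section \<open>Preliminaries\<close>

text \<open>The subsequence argument for filters: where convergence fails, the part of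
  \<open>F\<close> keeping distance \<open>e\<close> from \<open>d\<close> has a cluster point by
  compactness, and a finer filter converges to it. The filter form serves limits in time and limits
  within planar regions alike.\<close>

lemma tendsto_by_cluster_points:
  fixes g :: "'a \<Rightarrow> 'b::metric_space"
  assumes K: "compact K" and ev: "eventually (\<lambda>i. g i \<in> K) F"
    and lim: "\<And>G v. G \<le> F \<Longrightarrow> G \<noteq> bot \<Longrightarrow> (g \<longlongrightarrow> v) G \<Longrightarrow> v = d"
  shows "(g \<longlongrightarrow> d) F"
proof (rule ccontr)
  assume "\<not> (g \<longlongrightarrow> d) F"
  then obtain e where e: "e > 0" and ne: "\<not> eventually (\<lambda>i. dist (g i) d < e) F"
    unfolding tendsto_iff by auto
  define F' where "F' = inf F (principal {i. \<not> dist (g i) d < e})"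
  have F'bot: "F' \<noteq> bot"
  proof
    assume "F' = bot"
    then have "eventually (\<lambda>_. False) F'" by simp
    then show False using ne unfolding F'_def eventually_inf_principal
      by (auto elim!: eventually_mono)
  qed
  have F'F: "F' \<le> F" unfolding F'_def by simp
  have "eventually (\<lambda>v. v \<in> K) (filtermap g F')"
    using ev F'F unfolding eventually_filtermap by (rule filter_leD[rotated])
  moreover have "filtermap g F' \<noteq> bot" using F'bot by (simp add: filtermap_bot_iff)
  ultimately obtain v where v: "v \<in> K" "inf (nhds v) (filtermap g F') \<noteq> bot"
    using K unfolding compact_filter by blast
  \<comment> \<open>Adding the preimages of the neighbourhoods of \<open>v\<close> turns clustering
    at \<open>v\<close> into convergence to \<open>v\<close>.\<close>
  define G where "G = inf F' (filtercomap g (nhds v))"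
  have Gbot: "G \<noteq> bot"
  proof
    assume "G = bot"
    then have "eventually (\<lambda>_. False) G" by simp
    then obtain P Q where PQ: "eventually P F'" "eventually Q (filtercomap g (nhds v))"
      "\<And>i. P i \<Longrightarrow> Q i \<Longrightarrow> False" unfolding G_def eventually_inf by auto
    then obtain R where R: "eventually R (nhds v)" "\<And>i. R (g i) \<Longrightarrow> Q i"
      unfolding eventually_filtercomap by auto
    have "eventually (\<lambda>w. \<not> R w) (filtermap g F')"
      unfolding eventually_filtermap using PQ(1) by eventually_elim (use PQ(3) R(2) in blast)
    then have "eventually (\<lambda>_. False) (inf (nhds v) (filtermap g F'))"
      unfolding eventually_inf using R(1) by (intro exI[of _ R] exI[of _ "\<lambda>w. \<not> R w"]) auto
    then show False using v(2) by (simp add: trivial_limit_def)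
  qed
  have "filterlim g (nhds v) G"
    unfolding G_def filterlim_iff_le_filtercomap by simp
  then have gv: "(g \<longlongrightarrow> v) G" .
  have "G \<le> F" using F'F unfolding G_def by (simp add: le_infI1)
  from lim[OF this Gbot gv] have "v = d" .
  with gv e have "eventually (\<lambda>i. dist (g i) d < e) G" by (simp add: tendsto_iff)
  moreover have "eventually (\<lambda>i. \<not> dist (g i) d < e) G"
    unfolding G_def F'_def
    by (rule filter_leD[OF inf_le1], rule filter_leD[OF inf_le2]) (simp add: eventually_principal)
  ultimately have "eventually (\<lambda>_. False) G" by eventually_elim simp
  with Gbot show False by (simp add: trivial_limit_def)
qed

text \<open>Serves to compare two straight lines at a time between two times at which their order is
  known.\<close>

lemma affine_nonpos:
  fixes A B s t :: real
  assumes "A + t * B \<le> 0" "A \<le> 0" "0 \<le> s" "s \<le> t"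
  shows "A + s * B \<le> 0"
proof (cases "B \<le> 0")
  case True
  then have "s * B \<le> 0" using assms by (simp add: mult_nonneg_nonpos)
  then show ?thesis using assms by simp
next
  case False
  then have "s * B \<le> t * B" using assms by (intro mult_right_mono) auto
  then show ?thesis using assms by simp
qed

text \<open>An endpoint outside \<open>U\<close> could be adjoined to the interval, giving a larger
  connected subset of the complement and contradicting maximality of the component.\<close>

lemma component_of_complement_endpoints:
  fixes l r c d :: real
  assumes C: "{c<..<d} \<in> components ({l..r} - U)"
  shows "c < d" "c \<in> U" "d \<in> U" "{c<..<d} \<inter> U = {}"
proof -
  have "{c<..<d} \<noteq> {}" using C by (rule in_components_nonempty)
  then show cd: "c < d" by auto
  have sub: "{c<..<d} \<subseteq> {l..r} - U" using C by (rule in_components_subset)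
  then show "{c<..<d} \<inter> U = {}" by auto
  have "closure {c<..<d} \<subseteq> closure {l..r}" using sub by (intro closure_mono) auto
  then have lr: "{c..d} \<subseteq> {l..r}" using cd by simp
  have m: "(c + d) / 2 \<in> {c<..<d}" using cd by auto
  show "c \<in> U"
  proof (rule ccontr)
    assume "c \<notin> U"
    then have "{c..<d} \<subseteq> {l..r} - U" using sub lr cd
      by (auto simp: subset_iff) (metis greaterThanLessThan_iff less_eq_real_def)
    moreover have "{c<..<d} \<inter> {c..<d} \<noteq> {}" using m by fastforce
    ultimately have "{c..<d} \<subseteq> {c<..<d}" using components_maximal[OF C, of "{c..<d}"] by auto
    then show False using cd by auto
  qed
  show "d \<in> U"
  proof (rule ccontr)
    assume "d \<notin> U"
    then have "{c<..d} \<subseteq> {l..r} - U" using sub lr cd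
      by (auto simp: subset_iff) (metis greaterThanLessThan_iff less_eq_real_def)
    moreover have "{c<..<d} \<inter> {c<..d} \<noteq> {}" using m by fastforce
    ultimately have "{c<..d} \<subseteq> {c<..<d}" using components_maximal[OF C, of "{c<..d}"] by auto
    then show False using cd by auto
  qed
qed

section \<open>Hopf--Lax minimizers and backward characteristics\<close>

text \<open>The integral in \<open>Efun\<close> enters the limit arguments only through
  \<open>Umax_iff\<close>. \<open>\<Phi>\<close> stands for a primitive of \<open>\<phi>\<close>,
  and its Lipschitz constant \<open>M\<close> will also bound the minimizers.\<close>

locale hopf_lax =
  fixes f \<phi> \<Phi> :: "real \<Rightarrow> real" and M :: real
  assumes speed_mono: "strict_mono (deriv f)"
    and speed_cont: "continuous_on UNIV (deriv f)"
    and f_diff: "\<And>u. f field_differentiable (at u)"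
    and Phi_lip: "\<And>x y. \<bar>\<Phi> x - \<Phi> y\<bar> \<le> M * \<bar>x - y\<bar>"
    and Umax_iff: "\<And>u x t. 0 < t \<Longrightarrow> u \<in> Umax f \<phi> x t \<longleftrightarrow>
      (\<forall>v. \<Phi> (x - t * deriv f u) + t * (u * deriv f u - f u)
         \<le> \<Phi> (x - t * deriv f v) + t * (v * deriv f v - f v))"
begin

abbreviation a :: "real \<Rightarrow> real" where "a \<equiv> deriv f"
abbreviation U :: "real \<Rightarrow> real \<Rightarrow> real set" where "U \<equiv> Umax f \<phi>"

definition h :: "real \<Rightarrow> real" where "h u = u * a u - f u"
definition cost :: "real \<Rightarrow> real \<Rightarrow> real \<Rightarrow> real" where
  "cost u x t = \<Phi> (x - t * a u) + t * h u"
text \<open>\<open>upper\<close> and \<open>lower\<close> name the extreme minimizers;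
  \<open>trace_eqs\<close> identifies them with the traces, which are defined as one-sided
  limits.\<close>

definition upper :: "real \<Rightarrow> real \<Rightarrow> real" where "upper x t = Sup (U x t)"
definition lower :: "real \<Rightarrow> real \<Rightarrow> real" where "lower x t = Inf (U x t)"

lemma in_U_iff: "0 < t \<Longrightarrow> u \<in> U x t \<longleftrightarrow> (\<forall>v. cost u x t \<le> cost v x t)"
  by (simp add: Umax_iff cost_def h_def)

lemma a_less_iff: "a u < a v \<longleftrightarrow> u < v"
  using speed_mono by (rule strict_mono_less)

lemma a_le_iff: "a u \<le> a v \<longleftrightarrow> u \<le> v"
  using speed_mono by (rule strict_mono_less_eq)

lemma a_eq_iff: "a u = a v \<longleftrightarrow> u = v"
  using speed_mono by (rule strict_mono_eq)

lemma M_nonneg: "0 \<le> M"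
  using Phi_lip[of 1 0] abs_ge_zero[of "\<Phi> 1 - \<Phi> 0"] by simp

lemma f_cont: "continuous_on UNIV f"
  using f_diff by (simp add: continuous_on_eq_continuous_at field_differentiable_imp_continuous_at)

lemma tendsto_a: "(u \<longlongrightarrow> v) F \<Longrightarrow> ((\<lambda>i. a (u i)) \<longlongrightarrow> a v) F"
  using speed_cont by (simp add: continuous_on_tendsto_compose)

lemma h_cont: "continuous_on UNIV h"
  unfolding h_def[abs_def] by (intro continuous_intros speed_cont f_cont)

lemma Phi_cont: "continuous_on UNIV \<Phi>"
proof (rule continuous_onI)
  fix x e :: real assume e: "0 < e"
  show "\<exists>d>0. \<forall>y\<in>UNIV. dist y x < d \<longrightarrow> dist (\<Phi> y) (\<Phi> x) \<le> e"
  proof (intro exI[of _ "e / (\<bar>M\<bar> + 1)"] conjI ballI impI)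
    show "0 < e / (\<bar>M\<bar> + 1)" using e by auto
    fix y assume "dist y x < e / (\<bar>M\<bar> + 1)"
    then have "(\<bar>M\<bar> + 1) * \<bar>y - x\<bar> < e"
      by (simp add: dist_real_def field_simps)
    moreover have "M * \<bar>y - x\<bar> \<le> (\<bar>M\<bar> + 1) * \<bar>y - x\<bar>"
      by (intro mult_right_mono) auto
    ultimately show "dist (\<Phi> y) (\<Phi> x) \<le> e"
      using Phi_lip[of y x] by (simp add: dist_real_def)
  qed
qed

lemma tendsto_Phi: "(u \<longlongrightarrow> v) F \<Longrightarrow> ((\<lambda>i. \<Phi> (u i)) \<longlongrightarrow> \<Phi> v) F"
  using Phi_cont by (simp add: continuous_on_tendsto_compose)

lemma tendsto_h: "(u \<longlongrightarrow> v) F \<Longrightarrow> ((\<lambda>i. h (u i)) \<longlongrightarrow> h v) F"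
  using h_cont by (simp add: continuous_on_tendsto_compose)

text \<open>\<open>h\<close> is the Legendre transform of \<open>f\<close> read off at the slope \<open>a u\<close>, where its derivative is \<open>u\<close>.\<close>

lemma h_gap:
  assumes "u \<noteq> v"
  shows "u * (a v - a u) < h v - h u"
proof -
  have der: "(f has_real_derivative a z) (at z)" for z
    using f_diff by (simp add: DERIV_deriv_iff_field_differentiable)
  have "f v - f u < (v - u) * a v"
  proof (cases "u < v")
    case True
    then obtain z where "u < z" "z < v" "f v - f u = (v - u) * a z"
      using MVT2[of u v f a] der by blast
    then show ?thesis using True by (simp add: a_less_iff)
  next
    case False
    then have "v < u" using assms by simp
    then obtain z where z: "v < z" "z < u" "f u - f v = (u - v) * a z"
      using MVT2[of v u f a] der by blast
    then have "(u - v) * a v < (u - v) * a z" by (simp add: a_less_iff)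
    then show ?thesis using z(3) by (simp add: algebra_simps)
  qed
  then show ?thesis by (simp add: h_def algebra_simps)
qed

section \<open>Minimizer sets: bounds, existence, compactness, uniqueness along
  characteristics\<close>

lemma cost_above:
  assumes t: "0 < t" and u: "u \<notin> {-M..M}"
  shows "\<exists>v\<in>{-M..M}. cost v x t < cost u x t"
proof -
  note M = M_nonneg
  \<comment> \<open>\<open>v\<close> is the projection of \<open>u\<close> to
    \<open>{-M..M}\<close>. By \<open>h_gap\<close>, passing from \<open>u\<close> to
    \<open>v\<close> lowers the \<open>h\<close> term by more than
    \<open>M * t * \<bar>a u - a v\<bar>\<close>, the largest increase of the \<open>\<Phi>\<close>
    term that the Lipschitz bound permits.\<close>
  define v where "v = (if M < u then M else -M)"
  have v: "v \<in> {-M..M}" "u \<noteq> v" using M u by (auto simp: v_def)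
  have "M * \<bar>a u - a v\<bar> = v * (a u - a v)"
    using u v(1) by (auto simp: v_def abs_if a_less_iff algebra_simps)
  also have "\<dots> < h u - h v" using h_gap[of v u] v(2) by simp
  finally have "t * (M * \<bar>a u - a v\<bar>) < t * (h u - h v)" using t by simp
  moreover have "\<Phi> (x - t * a v) - \<Phi> (x - t * a u) \<le> M * (t * \<bar>a u - a v\<bar>)"
  proof -
    have "\<bar>(x - t * a v) - (x - t * a u)\<bar> = t * \<bar>a u - a v\<bar>"
      using t by (simp add: abs_mult flip: right_diff_distrib)
    then show ?thesis using Phi_lip[of "x - t * a v" "x - t * a u"] by simp
  qed
  ultimately have "cost v x t < cost u x t" by (simp add: cost_def algebra_simps)
  then show ?thesis using v(1) by blast
qed

lemma U_bounded: "0 < t \<Longrightarrow> U x t \<subseteq> {-M..M}"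
  using cost_above in_U_iff by (metis linorder_not_less subsetI)

lemma U_nonempty:
  assumes t: "0 < t"
  shows "U x t \<noteq> {}"
proof -
  note M = M_nonneg
  have "continuous_on {-M..M} (\<lambda>u. cost u x t)"
    unfolding cost_def
    by (intro continuous_intros continuous_on_compose2[OF Phi_cont]
        continuous_on_subset[OF speed_cont] continuous_on_subset[OF h_cont]) auto
  then obtain u where u: "u \<in> {-M..M}" "\<And>v. v \<in> {-M..M} \<Longrightarrow> cost u x t \<le> cost v x t"
    using continuous_attains_inf[of "{-M..M}" "\<lambda>u. cost u x t"] M by auto
  have "cost u x t \<le> cost v x t" for v
  proof (cases "v \<in> {-M..M}")
    case False
    then obtain w where "w \<in> {-M..M}" "cost w x t < cost v x t" using cost_above[OF t] by blast
    then show ?thesis using u(2)[of w] by simp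
  qed (use u in auto)
  then show ?thesis using in_U_iff[OF t] by blast
qed

text \<open>The cost is jointly continuous in state, position and time, so minimality against each
  fixed competitor passes to the limit.\<close>

lemma U_closed_graph:
  assumes F: "F \<noteq> bot" and x: "(x \<longlongrightarrow> x0) F" and t: "(t \<longlongrightarrow> t0) F" and u: "(u \<longlongrightarrow> u0) F"
    and t0: "0 < t0" and ev: "eventually (\<lambda>i. u i \<in> U (x i) (t i)) F"
  shows "u0 \<in> U x0 t0"
  unfolding in_U_iff[OF t0]
proof
  fix v
  have pos: "eventually (\<lambda>i. 0 < t i) F" using t t0 by (rule order_tendstoD)
  show "cost u0 x0 t0 \<le> cost v x0 t0"
  proof (rule tendsto_le[OF F])
    show "((\<lambda>i. cost v (x i) (t i)) \<longlongrightarrow> cost v x0 t0) F"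
      unfolding cost_def by (intro tendsto_intros tendsto_Phi x t)
    show "((\<lambda>i. cost (u i) (x i) (t i)) \<longlongrightarrow> cost u0 x0 t0) F"
      unfolding cost_def by (intro tendsto_intros tendsto_Phi tendsto_h tendsto_a x t u)
    show "eventually (\<lambda>i. cost (u i) (x i) (t i) \<le> cost v (x i) (t i)) F"
      using ev pos by eventually_elim (simp add: in_U_iff)
  qed
qed

lemma U_compact:
  assumes t: "0 < t"
  shows "compact (U x t)"
proof -
  have "closed (U x t)"
    unfolding closed_sequential_limits
    using U_closed_graph[OF sequentially_bot tendsto_const tendsto_const _ t] by auto
  moreover have "bounded (U x t)" using U_bounded[OF t] bounded_closed_interval bounded_subset by blast
  ultimately show ?thesis by (simp add: compact_eq_bounded_closed)
qed

lemma upper_in_U: "0 < t \<Longrightarrow> upper x t \<in> U x t"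
  unfolding upper_def
  by (intro closed_contains_Sup U_nonempty compact_imp_closed U_compact
      bounded_imp_bdd_above compact_imp_bounded)

lemma lower_in_U: "0 < t \<Longrightarrow> lower x t \<in> U x t"
  unfolding lower_def
  by (intro closed_contains_Inf U_nonempty compact_imp_closed U_compact
      bounded_imp_bdd_below compact_imp_bounded)

lemma U_between:
  assumes "0 < t" "u \<in> U x t"
  shows "lower x t \<le> u" "u \<le> upper x t"
  unfolding lower_def upper_def using assms
  by (auto intro!: cInf_lower cSup_upper bounded_imp_bdd_below bounded_imp_bdd_above
      compact_imp_bounded U_compact)

lemma lower_le_upper: "0 < t \<Longrightarrow> lower x t \<le> upper x t"
  using U_between lower_in_U by blast

text \<open>Dynamic programming: the broken line with speed \<open>a u\<close> after time
  \<open>t\<close> and \<open>a v\<close> before it costs no more than the line of \<open>u\<close>.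
  The straight line with the same endpoints is strictly cheaper, by strict convexity of
  \<open>h\<close> as a function of the speed, which contradicts minimality of
  \<open>u\<close>.\<close>

lemma backward_unique:
  assumes u: "u \<in> U x0 t0" and t: "0 < t" "t < t0"
    and v: "v \<in> U (x0 + (t - t0) * a u) t"
  shows "v = u"
proof (rule ccontr)
  assume vu: "v \<noteq> u"
  define x where "x = x0 + (t - t0) * a u"
  \<comment> \<open>\<open>q\<close> is the mean speed of the broken line. It lies between
    \<open>a u\<close> and \<open>a v\<close>, so it is the speed of some state
    \<open>w\<close>.\<close>
  define q where "q = ((t0 - t) * a u + t * a v) / t0"
  have q0: "t0 * q = (t0 - t) * a u + t * a v" using t by (simp add: q_def)
  obtain w where w: "a w = q"
  proof -
    have mid: "min (a u) (a v) \<le> q \<and> q \<le> max (a u) (a v)"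
    proof -
      have "q = (1 - t / t0) * a u + (t / t0) * a v" using t by (simp add: q_def field_simps)
      moreover have "0 \<le> t / t0" "t / t0 \<le> 1" using t by auto
      ultimately show ?thesis
        using convex_bound_le[of "a u" "max (a u) (a v)" "a v" "1 - t / t0" "t / t0"]
          convex_bound_le[of "- a u" "- min (a u) (a v)" "- a v" "1 - t / t0" "t / t0"] by auto
    qed
    show ?thesis
    proof (cases "u \<le> v")
      case True
      then have "a u \<le> q" "q \<le> a v" using mid a_le_iff by (auto simp: min_def max_def)
      then show ?thesis using IVT'[of a u q v] True that continuous_on_subset[OF speed_cont] by blast
    next
      case False
      then have "a v \<le> q" "q \<le> a u" using mid a_le_iff by (auto simp: min_def max_def split: if_splits)
      then show ?thesis using IVT'[of a v q u] False that continuous_on_subset[OF speed_cont]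
        by (metis linear subset_UNIV)
    qed
  qed
  have wv: "w \<noteq> v"
  proof
    assume "w = v"
    then have "(t0 - t) * (a u - a v) = 0" using q0 w by (simp add: algebra_simps)
    then show False using t vu by (simp add: a_eq_iff)
  qed
  \<comment> \<open>Jensen's inequality: weighting the two gaps by \<open>t\<close> and
    \<open>t0 - t\<close> cancels the linear terms, because \<open>a w\<close> is the weighted mean.
    It is strict because of \<open>wv\<close>.\<close>
  have "t * (w * (a v - a w)) < t * (h v - h w)" using h_gap[OF wv] t by simp
  moreover have "(t0 - t) * (w * (a u - a w)) \<le> (t0 - t) * (h u - h w)"
    using h_gap[of w u] t by (cases "w = u") auto
  moreover have "t * (w * (a v - a w)) + (t0 - t) * (w * (a u - a w))
      = w * (((t0 - t) * a u + t * a v) - t0 * a w)"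
    by (simp add: algebra_simps)
  moreover have "\<dots> = 0" using q0 w by simp
  ultimately have "0 < t * (h v - h w) + (t0 - t) * (h u - h w)" by linarith
  then have conv: "t0 * h w < (t0 - t) * h u + t * h v" by (simp add: algebra_simps)
  have "cost u x0 t0 \<le> cost w x0 t0" using u t by (simp add: in_U_iff)
  moreover have "cost v x t \<le> cost u x t" using v t by (simp add: in_U_iff x_def)
  moreover have "x0 - t0 * a u = x - t * a u" by (simp add: x_def algebra_simps)
  moreover have "x0 - t0 * a w = x - t * a v" using q0 w by (simp add: x_def algebra_simps)
  ultimately show False using conv by (simp add: cost_def algebra_simps)
qed

section \<open>Order of backward characteristics and of their base points\<close>

lemma crossing_imp_eq:
  assumes u: "u \<in> U x t" and v: "v \<in> U y r" and s: "0 < s" "s < t" "s \<le> r"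
    and eq: "x + (s - t) * a u = y + (s - r) * a v"
  shows "u = v"
proof (cases "s = r")
  case True
  then have "v \<in> U (x + (s - t) * a u) s" using eq v by simp
  then show ?thesis using backward_unique[OF u s(1,2)] by metis
next
  case False
  \<comment> \<open>Here the crossing point is interior to both characteristics, so any minimizer
    there equals both states.\<close>
  obtain w where w: "w \<in> U (x + (s - t) * a u) s" using U_nonempty[OF s(1)] by blast
  then have "w = u" using backward_unique[OF u s(1,2)] by simp
  moreover have "w = v" using backward_unique[OF v s(1)] w eq False s by simp
  ultimately show ?thesis by simp
qed

text \<open>Base points in the opposite strict order would force the two lines to meet at some time
  \<open>z\<close> in \<open>(0, s)\<close>. Then \<open>crossing_imp_eq\<close> makes them
  parallel, although their distance changes sign.\<close>

lemma no_cross: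
  assumes u: "u \<in> U x t" and v: "v \<in> U y r" and s: "0 < s" "s \<le> t" "s \<le> r"
    and lt: "x + (s - t) * a u < y + (s - r) * a v"
  shows "x - t * a u \<le> y - r * a v"
proof (rule ccontr)
  assume "\<not> x - t * a u \<le> y - r * a v"
  then have A: "0 < (x - t * a u) - (y - r * a v)" (is "0 < ?A") by simp
  define B where "B = a u - a v"
  have AB: "?A + s * B < 0" using lt by (simp add: B_def algebra_simps)
  define z where "z = - ?A / B"
  have B: "B < 0" using A AB s by (smt (verit) mult_nonneg_nonneg)
  have z0: "0 < z" using A B by (simp add: z_def divide_pos_neg divide_neg_neg)
  have zeq: "?A + z * B = 0" using B by (simp add: z_def)
  have "s * B < z * B" using AB zeq by linarith
  then have zs: "z < s" using B by (simp add: mult_less_cancel_right)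
  have "x + (z - t) * a u = y + (z - r) * a v" using zeq by (simp add: B_def algebra_simps)
  then have "u = v" using crossing_imp_eq[OF u v z0] zs s by simp
  then show False using B by (simp add: B_def)
qed

text \<open>In the case of equality at time \<open>s\<close>, one line must continue beyond
  \<open>s\<close>: a single point at time \<open>s\<close> may have several minimizers with
  different base points.\<close>

lemma no_cross_le:
  assumes u: "u \<in> U x t" and v: "v \<in> U y r" and s: "0 < s" "s \<le> t" "s \<le> r" "s < t \<or> s < r"
    and le: "x + (s - t) * a u \<le> y + (s - r) * a v"
  shows "x - t * a u \<le> y - r * a v"
proof (cases "x + (s - t) * a u = y + (s - r) * a v")
  case True
  have "u = v"
    using crossing_imp_eq[OF u v s(1)] crossing_imp_eq[OF v u s(1)] True s by auto
  then show ?thesis using True by (simp add: algebra_simps)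
next
  case False
  then show ?thesis using no_cross[OF u v s(1-3)] le by simp
qed

section \<open>Limits of minimizers and the traces\<close>

text \<open>The common mechanism of all the limits: minimizers stay bounded, their cluster points
  are minimizers at \<open>(x0, t0)\<close> by the closed graph, and the closed set \<open>C\<close>
  of allowed base points leaves only \<open>d\<close>.\<close>

lemma minimizer_tendsto:
  assumes x: "(x \<longlongrightarrow> x0) F" and t: "(t \<longlongrightarrow> t0) F" and t0: "0 < t0"
    and uU: "eventually (\<lambda>i. u i \<in> U (x i) (t i)) F"
    and C: "closed C" and base: "eventually (\<lambda>i. x i - t i * a (u i) \<in> C) F"
    and uniq: "\<And>v. v \<in> U x0 t0 \<Longrightarrow> x0 - t0 * a v \<in> C \<Longrightarrow> v = d"
  shows "(u \<longlongrightarrow> d) F"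
proof (rule tendsto_by_cluster_points)
  have "eventually (\<lambda>i. 0 < t i) F" using t t0 by (rule order_tendstoD)
  with uU show "eventually (\<lambda>i. u i \<in> {-M..M}) F"
    by eventually_elim (use U_bounded in blast)
  show "compact {-M..M}" by simp
  fix G v assume G: "G \<le> F" "G \<noteq> bot" and uv: "(u \<longlongrightarrow> v) G"
  note x' = tendsto_mono[OF G(1) x] and t' = tendsto_mono[OF G(1) t]
  have "v \<in> U x0 t0"
    using U_closed_graph[OF G(2) x' t' uv t0 filter_leD[OF G(1) uU]] .
  moreover have "x0 - t0 * a v \<in> C"
    by (rule Lim_in_closed_set[OF C filter_leD[OF G(1) base] G(2)])
      (intro tendsto_intros tendsto_a x' t' uv)
  ultimately show "v = d" by (rule uniq)
qed

text \<open>By \<open>no_cross\<close>, minimizers at points left of \<open>x\<close> have base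
  points no further right than that of \<open>upper x t\<close>, which is the leftmost base point at
  \<open>x\<close> because \<open>a\<close> increases. The right trace is symmetric.\<close>

lemma trace_eqs:
  assumes t: "0 < t"
  shows "uleft f \<phi> x t = upper x t" and "uright f \<phi> x t = lower x t"
proof -
  have us: "usol f \<phi> y t \<in> U y t" for y using lower_in_U[OF t] by (simp add: usol_def lower_def)
  have "((\<lambda>y. usol f \<phi> y t) \<longlongrightarrow> upper x t) (at_left x)"
  proof (rule minimizer_tendsto[where x = "\<lambda>y. y" and t = "\<lambda>_. t" and C = "{..x - t * a (upper x t)}"])
    show "eventually (\<lambda>y. y - t * a (usol f \<phi> y t) \<in> {..x - t * a (upper x t)}) (at_left x)"
      unfolding eventually_at_filter
      by (intro always_eventually) (use no_cross[OF us upper_in_U[OF t] t] in auto)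
    show "v = upper x t" if "v \<in> U x t" "x - t * a v \<in> {..x - t * a (upper x t)}" for v
      using that t U_between[OF t that(1)] by (auto simp: a_le_iff)
  qed (use t us in auto)
  then show "uleft f \<phi> x t = upper x t" unfolding uleft_def by (intro tendsto_Lim) auto
  have "((\<lambda>y. usol f \<phi> y t) \<longlongrightarrow> lower x t) (at_right x)"
  proof (rule minimizer_tendsto[where x = "\<lambda>y. y" and t = "\<lambda>_. t" and C = "{x - t * a (lower x t)..}"])
    show "eventually (\<lambda>y. y - t * a (usol f \<phi> y t) \<in> {x - t * a (lower x t)..}) (at_right x)"
      unfolding eventually_at_filter
      by (intro always_eventually) (use no_cross[OF lower_in_U[OF t] us t] in auto)
    show "v = lower x t" if "v \<in> U x t" "x - t * a v \<in> {x - t * a (lower x t)..}" for v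
      using that t U_between[OF t that(1)] by (auto simp: a_le_iff)
  qed (use t us in auto)
  then show "uright f \<phi> x t = lower x t" unfolding uright_def by (intro tendsto_Lim) auto
qed

lemma Iset_eq: "0 < t \<Longrightarrow> Iset f \<phi> x t = {lower x t..upper x t}"
  by (simp add: Iset_def trace_eqs)

lemma traces_tendsto:
  assumes x: "(x \<longlongrightarrow> x0) F" and t: "(t \<longlongrightarrow> t0) F" and t0: "0 < t0" and C: "closed C"
    and base: "eventually (\<lambda>i. \<forall>v\<in>U (x i) (t i). x i - t i * a v \<in> C) F"
    and uniq: "\<And>v. v \<in> U x0 t0 \<Longrightarrow> x0 - t0 * a v \<in> C \<Longrightarrow> v = d"
  shows "((\<lambda>i. uleft f \<phi> (x i) (t i)) \<longlongrightarrow> d) F" "((\<lambda>i. uright f \<phi> (x i) (t i)) \<longlongrightarrow> d) F"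
proof -
  have pos: "eventually (\<lambda>i. 0 < t i) F" using t t0 by (rule order_tendstoD)
  show "((\<lambda>i. uleft f \<phi> (x i) (t i)) \<longlongrightarrow> d) F"
    by (rule minimizer_tendsto[OF x t t0 _ C _ uniq])
      (use pos base in \<open>eventually_elim, auto simp: trace_eqs upper_in_U\<close>)+
  show "((\<lambda>i. uright f \<phi> (x i) (t i)) \<longlongrightarrow> d) F"
    by (rule minimizer_tendsto[OF x t t0 _ C _ uniq])
      (use pos base in \<open>eventually_elim, auto simp: trace_eqs lower_in_U\<close>)+
qed

section \<open>Forward generalized characteristics\<close>

text \<open>Backward in time the largest state bounds a fan on the left and the smallest on the
  right. The fans contain only open times; continuity adds \<open>s = 0\<close>, which gives base
  points, and \<open>s = t\<close>, which gives positions.\<close>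

lemma Delta_Icc_subset_bounds:
  assumes sub: "Delta f {\<alpha>..\<beta>} x t \<subseteq> Delta f {\<gamma>..\<delta>} y r" and tr: "0 < t" "t \<le> r"
    and u: "u \<in> {\<alpha>..\<beta>}" and s: "0 \<le> s" "s \<le> t"
  shows "y + (s - r) * a \<delta> \<le> x + (s - t) * a u" "x + (s - t) * a u \<le> y + (s - r) * a \<gamma>"
proof -
  have open_case: "y + (z - r) * a \<delta> \<le> x + (z - t) * a u \<and> x + (z - t) * a u \<le> y + (z - r) * a \<gamma>"
    if z: "z \<in> {0<..<t}" for z
  proof -
    have "(x + (z - t) * a u, z) \<in> Delta f {\<alpha>..\<beta>} x t"
      using u z by (auto simp: Delta_def lseg_def)
    then have "(x + (z - t) * a u, z) \<in> Delta f {\<gamma>..\<delta>} y r" using sub by blast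
    then obtain v where v: "v \<in> {\<gamma>..\<delta>}" "x + (z - t) * a u = y + (z - r) * a v"
      by (auto simp: Delta_def lseg_def)
    have "(z - r) * a \<delta> \<le> (z - r) * a v" "(z - r) * a v \<le> (z - r) * a \<gamma>"
      using v(1) z tr by (auto intro!: mult_left_mono_neg simp: a_le_iff)
    then show ?thesis using v(2) by simp
  qed
  have cl: "s \<in> closure {0<..<t}" using tr s by simp
  have "0 \<le> (x + (s - t) * a u) - (y + (s - r) * a \<delta>)"
    by (rule continuous_ge_on_closure[OF _ cl])
      (use open_case in \<open>auto intro!: continuous_intros\<close>)
  then show "y + (s - r) * a \<delta> \<le> x + (s - t) * a u" by simp
  have "0 \<le> (y + (s - r) * a \<gamma>) - (x + (s - t) * a u)"
    by (rule continuous_ge_on_closure[OF _ cl])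
      (use open_case in \<open>auto intro!: continuous_intros\<close>)
  then show "x + (s - t) * a u \<le> y + (s - r) * a \<gamma>" by simp
qed

lemma fwd_char_bounds:
  assumes X: "fwd_char f \<phi> x0 t0 X" and t: "0 < t0" "t0 \<le> t1" "t1 \<le> t2"
    and u: "u \<in> {lower (X t1) t1..upper (X t1) t1}" and s: "0 \<le> s" "s \<le> t1"
  shows "X t2 + (s - t2) * a (upper (X t2) t2) \<le> X t1 + (s - t1) * a u"
    "X t1 + (s - t1) * a u \<le> X t2 + (s - t2) * a (lower (X t2) t2)"
proof -
  have "Delta f {lower (X t1) t1..upper (X t1) t1} (X t1) t1
      \<subseteq> Delta f {lower (X t2) t2..upper (X t2) t2} (X t2) t2"
  proof (cases "t1 = t2")
    case False
    then have t12: "t1 < t2" using t by simp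
    have X0: "X t0 = x0" using X by (simp add: fwd_char_def)
    have "Delta f (Iset f \<phi> (X t1) t1) (X t1) t1 \<subseteq> Delta f (Iset f \<phi> (X t2) t2) (X t2) t2"
    proof (cases "t0 = t1")
      \<comment> \<open>The inclusion from the starting time is the first clause of
        \<open>fwd_char\<close>, which asks for a further later time; \<open>t2 + 1\<close> supplies
        it.\<close>
      case True
      then have "t0 < t2" "t2 < t2 + 1" using t12 by auto
      then show ?thesis using X X0 True unfolding fwd_char_def by blast
    next
      case False
      then show ?thesis using X t12 t unfolding fwd_char_def by auto
    qed
    then show ?thesis using t t12 by (simp add: Iset_eq)
  qed simp
  from Delta_Icc_subset_bounds[OF this _ t(3) u s] t(1,2)
  show "X t2 + (s - t2) * a (upper (X t2) t2) \<le> X t1 + (s - t1) * a u"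
    "X t1 + (s - t1) * a u \<le> X t2 + (s - t2) * a (lower (X t2) t2)" by auto
qed

text \<open>The case \<open>s = 0\<close> of the bounds: the footprint of the backward fan at time
  \<open>0\<close> grows along the curve.\<close>

lemma fwd_char_base_mono:
  assumes X: "fwd_char f \<phi> x0 t0 X" and t: "0 < t0" "t0 \<le> t1" "t1 \<le> t2"
  shows "X t2 - t2 * a (upper (X t2) t2) \<le> X t1 - t1 * a (upper (X t1) t1)"
    "X t1 - t1 * a (lower (X t1) t1) \<le> X t2 - t2 * a (lower (X t2) t2)"
  using fwd_char_bounds(1)[OF X t, of "upper (X t1) t1" 0]
    fwd_char_bounds(2)[OF X t, of "lower (X t1) t1" 0] lower_le_upper[of t1 "X t1"] t
  by auto

lemma speed_bounded:
  obtains K where "\<And>x t u. 0 < t \<Longrightarrow> u \<in> U x t \<Longrightarrow> \<bar>a u\<bar> \<le> K"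
proof
  fix x t u assume "0 < t" "u \<in> U x t"
  then have "u \<in> {-M..M}" using U_bounded by blast
  then have "a (-M) \<le> a u" "a u \<le> a M" by (auto simp: a_le_iff)
  then show "\<bar>a u\<bar> \<le> max \<bar>a (-M)\<bar> \<bar>a M\<bar>" by linarith
qed

text \<open>Continuity is not part of \<open>fwd_char\<close> but follows from the nesting: the
  earlier point lies between the extreme backward lines of the later one, whose speeds are uniformly
  bounded.\<close>

lemma fwd_char_lipschitz:
  assumes X: "fwd_char f \<phi> x0 t0 X" and t0: "0 < t0"
  obtains K where "\<And>t1 t2. t0 \<le> t1 \<Longrightarrow> t1 \<le> t2 \<Longrightarrow> \<bar>X t2 - X t1\<bar> \<le> K * (t2 - t1)"
proof -
  obtain K where K: "\<And>x t u. 0 < t \<Longrightarrow> u \<in> U x t \<Longrightarrow> \<bar>a u\<bar> \<le> K" using speed_bounded by blast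
  have "\<bar>X t2 - X t1\<bar> \<le> K * (t2 - t1)" if t: "t0 \<le> t1" "t1 \<le> t2" for t1 t2
  proof -
    have t12: "0 < t1" "0 < t2" using t t0 by auto
    have l: "lower (X t1) t1 \<in> {lower (X t1) t1..upper (X t1) t1}"
      using lower_le_upper[OF t12(1)] by simp
    have "X t2 + (t1 - t2) * a (upper (X t2) t2) \<le> X t1"
      "X t1 \<le> X t2 + (t1 - t2) * a (lower (X t2) t2)"
      using fwd_char_bounds[OF X t0 t l, of t1] t12 by auto
    moreover have "\<bar>(t1 - t2) * a v\<bar> \<le> K * (t2 - t1)" if "v \<in> U (X t2) t2" for v
    proof -
      have "\<bar>a v\<bar> * (t2 - t1) \<le> K * (t2 - t1)" using K[OF t12(2) that] t by (intro mult_right_mono) auto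
      then show ?thesis using t by (simp add: abs_mult mult.commute)
    qed
    note this[OF upper_in_U[OF t12(2)]] this[OF lower_in_U[OF t12(2)]]
    ultimately show ?thesis by linarith
  qed
  then show ?thesis using that by blast
qed

lemma fwd_char_tendsto_start:
  assumes X: "fwd_char f \<phi> x0 t0 X" and t0: "0 < t0"
  shows "(X \<longlongrightarrow> x0) (at_right t0)"
proof -
  obtain K where K: "\<And>t1 t2. t0 \<le> t1 \<Longrightarrow> t1 \<le> t2 \<Longrightarrow> \<bar>X t2 - X t1\<bar> \<le> K * (t2 - t1)"
    using fwd_char_lipschitz[OF X t0] by blast
  have X0: "X t0 = x0" using X by (simp add: fwd_char_def)
  have "((\<lambda>t. X t - x0) \<longlongrightarrow> 0) (at_right t0)"
  proof (rule Lim_null_comparison)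
    show "eventually (\<lambda>t. norm (X t - x0) \<le> K * (t - t0)) (at_right t0)"
      unfolding eventually_at_filter
      by (intro always_eventually) (use K[of t0] X0 in auto)
    have "((\<lambda>t. K * (t - t0)) \<longlongrightarrow> K * (t0 - t0)) (at_right t0)" by (intro tendsto_intros)
    then show "((\<lambda>t. K * (t - t0)) \<longlongrightarrow> 0) (at_right t0)" by simp
  qed
  then show ?thesis by (simp add: LIM_zero_iff)
qed

section \<open>One-sided limits at the starting point of a forward characteristic\<close>

lemma tendsto_fst_at: "(fst \<longlongrightarrow> x0) (at (x0, t0) within S)"
  using tendsto_fst[OF tendsto_ident_at, of "(x0, t0)" S] by simp

lemma tendsto_snd_at: "(snd \<longlongrightarrow> t0) (at (x0, t0) within S)"
  using tendsto_snd[OF tendsto_ident_at, of "(x0, t0)" S] by simp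

text \<open>Points left of the curve have all base points at most \<open>b\<close>, the leftmost
  base point at \<open>(x0, t0)\<close>: from \<open>t0\<close> on by comparison with the leftmost
  line from \<open>(X t, t)\<close>, before \<open>t0\<close> with the line of
  \<open>upper x0 t0\<close>. Only that minimizer has a base point at most \<open>b\<close>.\<close>

lemma limits_left_of_char:
  assumes t0: "0 < t0" and X: "fwd_char f \<phi> x0 t0 X"
  shows "((\<lambda>(x, t). uleft f \<phi> x t) \<longlongrightarrow> uleft f \<phi> x0 t0) (at (x0, t0) within Delta_minus f \<phi> x0 t0 X)"
    "((\<lambda>(x, t). uright f \<phi> x t) \<longlongrightarrow> uleft f \<phi> x0 t0) (at (x0, t0) within Delta_minus f \<phi> x0 t0 X)"
    "((\<lambda>t. uleft f \<phi> (X t) t) \<longlongrightarrow> uleft f \<phi> x0 t0) (at_right t0)"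
proof -
  define b where "b = x0 - t0 * a (upper x0 t0)"
  have X0: "X t0 = x0" using X by (simp add: fwd_char_def)
  have Xb: "X t - t * a (upper (X t) t) \<le> b" if "t0 \<le> t" for t
    using fwd_char_base_mono(1)[OF X t0 order_refl that] X0 by (simp add: b_def)
  have uniq: "v = upper x0 t0" if "v \<in> U x0 t0" "x0 - t0 * a v \<in> {..b}" for v
    using that t0 U_between[OF t0 that(1)] by (auto simp: a_le_iff b_def)
  have base: "x - t * a v \<le> b" if p: "(x, t) \<in> Delta_minus f \<phi> x0 t0 X" and v: "v \<in> U x t" for x t v
  proof (cases "t0 \<le> t")
    case True
    then have t: "0 < t" "x < X t" using p t0 by (auto simp: Delta_minus_def)
    have "x - t * a v \<le> X t - t * a (upper (X t) t)"
      using no_cross[OF v upper_in_U[OF t(1), of "X t"] t(1)] t(2) by simp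
    then show ?thesis using Xb[OF True] by simp
  next
    case False
    then have t: "0 < t" "x < x0 + (t - t0) * a (upper x0 t0)"
      using p t0 by (auto simp: Delta_minus_def trace_eqs)
    then show ?thesis
      using no_cross[OF v upper_in_U[OF t0, of x0] t(1)] False by (simp add: b_def)
  qed
  have ev: "eventually (\<lambda>p. \<forall>v\<in>U (fst p) (snd p). fst p - snd p * a v \<in> {..b})
      (at (x0, t0) within Delta_minus f \<phi> x0 t0 X)"
    unfolding eventually_at_filter by (intro always_eventually) (use base in auto)
  note L = traces_tendsto[OF tendsto_fst_at tendsto_snd_at t0 closed_atMost ev uniq]
  from L show "((\<lambda>(x, t). uleft f \<phi> x t) \<longlongrightarrow> uleft f \<phi> x0 t0) (at (x0, t0) within Delta_minus f \<phi> x0 t0 X)"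
    "((\<lambda>(x, t). uright f \<phi> x t) \<longlongrightarrow> uleft f \<phi> x0 t0) (at (x0, t0) within Delta_minus f \<phi> x0 t0 X)"
    by (simp_all add: trace_eqs[OF t0] split_def)
  have "((\<lambda>t. uleft f \<phi> (X t) t) \<longlongrightarrow> upper x0 t0) (at_right t0)"
  proof (rule minimizer_tendsto[OF fwd_char_tendsto_start[OF X t0] _ t0 _ closed_atMost _ uniq])
    show "eventually (\<lambda>t. uleft f \<phi> (X t) t \<in> U (X t) t) (at_right t0)"
      unfolding eventually_at_filter
      by (intro always_eventually) (use t0 in \<open>auto simp: trace_eqs upper_in_U\<close>)
    show "eventually (\<lambda>t. X t - t * a (uleft f \<phi> (X t) t) \<in> {..b}) (at_right t0)"
      unfolding eventually_at_filter
      by (intro always_eventually) (use t0 Xb in \<open>auto simp: trace_eqs\<close>)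
  qed auto
  then show "((\<lambda>t. uleft f \<phi> (X t) t) \<longlongrightarrow> uleft f \<phi> x0 t0) (at_right t0)"
    by (simp add: trace_eqs[OF t0])
qed

text \<open>Mirror image, with \<open>b\<close> now the rightmost base point at
  \<open>(x0, t0)\<close>.\<close>

lemma limits_right_of_char:
  assumes t0: "0 < t0" and X: "fwd_char f \<phi> x0 t0 X"
  shows "((\<lambda>(x, t). uleft f \<phi> x t) \<longlongrightarrow> uright f \<phi> x0 t0) (at (x0, t0) within Delta_plus f \<phi> x0 t0 X)"
    "((\<lambda>(x, t). uright f \<phi> x t) \<longlongrightarrow> uright f \<phi> x0 t0) (at (x0, t0) within Delta_plus f \<phi> x0 t0 X)"
    "((\<lambda>t. uright f \<phi> (X t) t) \<longlongrightarrow> uright f \<phi> x0 t0) (at_right t0)"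
proof -
  define b where "b = x0 - t0 * a (lower x0 t0)"
  have X0: "X t0 = x0" using X by (simp add: fwd_char_def)
  have Xb: "b \<le> X t - t * a (lower (X t) t)" if "t0 \<le> t" for t
    using fwd_char_base_mono(2)[OF X t0 order_refl that] X0 by (simp add: b_def)
  have uniq: "v = lower x0 t0" if "v \<in> U x0 t0" "x0 - t0 * a v \<in> {b..}" for v
    using that t0 U_between[OF t0 that(1)] by (auto simp: a_le_iff b_def)
  have base: "b \<le> x - t * a v" if p: "(x, t) \<in> Delta_plus f \<phi> x0 t0 X" and v: "v \<in> U x t" for x t v
  proof (cases "t0 \<le> t")
    case True
    then have t: "0 < t" "X t < x" using p t0 by (auto simp: Delta_plus_def)
    have "X t - t * a (lower (X t) t) \<le> x - t * a v"
      using no_cross[OF lower_in_U[OF t(1), of "X t"] v t(1)] t(2) by simp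
    then show ?thesis using Xb[OF True] by simp
  next
    case False
    then have t: "0 < t" "x0 + (t - t0) * a (lower x0 t0) < x"
      using p t0 by (auto simp: Delta_plus_def trace_eqs)
    then show ?thesis
      using no_cross[OF lower_in_U[OF t0, of x0] v t(1)] False by (simp add: b_def)
  qed
  have ev: "eventually (\<lambda>p. \<forall>v\<in>U (fst p) (snd p). fst p - snd p * a v \<in> {b..})
      (at (x0, t0) within Delta_plus f \<phi> x0 t0 X)"
    unfolding eventually_at_filter by (intro always_eventually) (use base in auto)
  note L = traces_tendsto[OF tendsto_fst_at tendsto_snd_at t0 closed_atLeast ev uniq]
  from L show "((\<lambda>(x, t). uleft f \<phi> x t) \<longlongrightarrow> uright f \<phi> x0 t0) (at (x0, t0) within Delta_plus f \<phi> x0 t0 X)"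
    "((\<lambda>(x, t). uright f \<phi> x t) \<longlongrightarrow> uright f \<phi> x0 t0) (at (x0, t0) within Delta_plus f \<phi> x0 t0 X)"
    by (simp_all add: trace_eqs[OF t0] split_def)
  have "((\<lambda>t. uright f \<phi> (X t) t) \<longlongrightarrow> lower x0 t0) (at_right t0)"
  proof (rule minimizer_tendsto[OF fwd_char_tendsto_start[OF X t0] _ t0 _ closed_atLeast _ uniq])
    show "eventually (\<lambda>t. uright f \<phi> (X t) t \<in> U (X t) t) (at_right t0)"
      unfolding eventually_at_filter
      by (intro always_eventually) (use t0 in \<open>auto simp: trace_eqs lower_in_U\<close>)
    show "eventually (\<lambda>t. X t - t * a (uright f \<phi> (X t) t) \<in> {b..}) (at_right t0)"
      unfolding eventually_at_filter
      by (intro always_eventually) (use t0 Xb in \<open>auto simp: trace_eqs\<close>)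
  qed auto
  then show "((\<lambda>t. uright f \<phi> (X t) t) \<longlongrightarrow> uright f \<phi> x0 t0) (at_right t0)"
    by (simp add: trace_eqs[OF t0])
qed

section \<open>Characteristics starting in a gap of the minimizers\<close>

context
  fixes x0 t0 c d w tn :: real and Y :: "real \<Rightarrow> real"
  assumes gap: "c \<in> U x0 t0" "d \<in> U x0 t0" "{c<..<d} \<inter> U x0 t0 = {}"
    and w: "c < w" "w < d" and tn: "0 < tn" "tn < t0"
    and Y: "fwd_char f \<phi> (x0 + (tn - t0) * a w) tn Y"
begin

lemma t0_pos: "0 < t0" using tn by simp

text \<open>If the curve were on or left of the line of \<open>d\<close> at time \<open>t\<close>,
  its \<open>lower\<close> backward line would be weakly left of it at \<open>t\<close>, at time
  \<open>0\<close> by \<open>no_cross_le\<close>, hence at \<open>tn\<close>. But at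
  \<open>tn\<close> that backward line is weakly right of \<open>Y tn\<close>, which is strictly
  right of the line of \<open>d\<close>. The side of \<open>c\<close> is symmetric.\<close>

lemma gap_char_between:
  assumes t: "tn \<le> t" "t < t0"
  shows "x0 + (t - t0) * a d < Y t" "Y t < x0 + (t - t0) * a c"
proof -
  have t': "0 < t" using t tn by simp
  have Yn: "Y tn = x0 + (tn - t0) * a w" using Y by (simp add: fwd_char_def)
  have ln: "lower (Y tn) tn \<in> {lower (Y tn) tn..upper (Y tn) tn}"
    using lower_le_upper[OF tn(1)] by simp
  have n: "Y t + (tn - t) * a (upper (Y t) t) \<le> Y tn" "Y tn \<le> Y t + (tn - t) * a (lower (Y t) t)"
    using fwd_char_bounds[OF Y tn(1) order_refl t(1) ln, of tn] tn by auto
  have wd: "x0 + (tn - t0) * a d < Y tn" "Y tn < x0 + (tn - t0) * a c"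
    using w tn by (auto simp: Yn a_less_iff)
  show "x0 + (t - t0) * a d < Y t"
  proof (rule ccontr)
    assume "\<not> x0 + (t - t0) * a d < Y t"
    then have le: "Y t \<le> x0 + (t - t0) * a d" by simp
    let ?u = "lower (Y t) t"
    have "Y t - t * a ?u \<le> x0 - t0 * a d"
      using no_cross_le[OF lower_in_U[OF t'] gap(2) t'] le t by simp
    then have "((Y t - t * a ?u) - (x0 - t0 * a d)) + tn * (a ?u - a d) \<le> 0"
      using affine_nonpos[of "(Y t - t * a ?u) - (x0 - t0 * a d)" t "a ?u - a d" tn] le t tn
      by (simp add: algebra_simps)
    then show False using n(2) wd(1) by (simp add: algebra_simps)
  qed
  show "Y t < x0 + (t - t0) * a c"
  proof (rule ccontr)
    assume "\<not> Y t < x0 + (t - t0) * a c"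
    then have le: "x0 + (t - t0) * a c \<le> Y t" by simp
    let ?u = "upper (Y t) t"
    have "x0 - t0 * a c \<le> Y t - t * a ?u"
      using no_cross_le[OF gap(1) upper_in_U[OF t'] t'] le t by simp
    then have "((x0 - t0 * a c) - (Y t - t * a ?u)) + tn * (a c - a ?u) \<le> 0"
      using affine_nonpos[of "(x0 - t0 * a c) - (Y t - t * a ?u)" t "a c - a ?u" tn] le t tn
      by (simp add: algebra_simps)
    then show False using n(1) wd(2) by (simp add: algebra_simps)
  qed
qed

lemma gap_char_tendsto: "(Y \<longlongrightarrow> x0) (at_left t0)"
proof (rule tendsto_sandwich)
  have ev: "eventually (\<lambda>t. tn < t \<and> t < t0) (at_left t0)"
    using tn by (auto simp: eventually_at_left_field)
  show "eventually (\<lambda>t. x0 + (t - t0) * a d \<le> Y t) (at_left t0)"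
    using ev by eventually_elim (simp add: gap_char_between(1) less_imp_le)
  show "eventually (\<lambda>t. Y t \<le> x0 + (t - t0) * a c) (at_left t0)"
    using ev by eventually_elim (simp add: gap_char_between(2) less_imp_le)
  have "((\<lambda>t. x0 + (t - t0) * a v) \<longlongrightarrow> x0 + (t0 - t0) * a v) (at_left t0)" for v
    by (intro tendsto_intros)
  then show "((\<lambda>t. x0 + (t - t0) * a d) \<longlongrightarrow> x0) (at_left t0)"
    "((\<lambda>t. x0 + (t - t0) * a c) \<longlongrightarrow> x0) (at_left t0)" by simp_all
qed

text \<open>
  Without a shock the nested triangles degenerate to segments of one straight line, which reaches
  \<open>(x\<^sub>0, t\<^sub>0)\<close> strictly between the lines of \<open>c\<close> and \<open>d\<close>; by closedness its state would be a
  minimizer in the gap.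
\<close>

lemma gap_char_shock:
  obtains th where "tn < th" "th < t0" "lower (Y th) th < upper (Y th) th"
proof (rule ccontr)
  note found = that
  assume neg: "\<not> thesis"
  have eq: "upper (Y t) t = lower (Y t) t" if "tn < t" "t < t0" for t
  proof (rule ccontr)
    assume "upper (Y t) t \<noteq> lower (Y t) t"
    then have "lower (Y t) t < upper (Y t) t" using lower_le_upper[of t "Y t"] tn that by simp
    then show False using neg found that by blast
  qed
  define r where "r = (tn + t0) / 2"
  have r: "tn < r" "r < t0" "0 < r" using tn by (auto simp: r_def)
  define u where "u = lower (Y r) r"
  have line: "lower (Y t) t = u \<and> Y t = Y r + (t - r) * a u" if t: "r \<le> t" "t < t0" for t
  proof -
    have u: "u \<in> {lower (Y r) r..upper (Y r) r}" using eq r by (simp add: u_def)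
    \<comment> \<open>With one minimizer at time \<open>t\<close>, the lower and upper bounds of
      \<open>fwd_char_bounds\<close> coincide; \<open>s = 0\<close> and \<open>s = r\<close> then
      determine slope and position.\<close>
    have st: "Y t + (s - t) * a (lower (Y t) t) = Y r + (s - r) * a u" if "0 \<le> s" "s \<le> r" for s
      using fwd_char_bounds[OF Y tn(1) _ t(1) u that] eq[of t] r t by simp
    have "r * a (lower (Y t) t) = r * a u"
    proof -
      have "Y t - t * a (lower (Y t) t) = Y r - r * a u" using st[of 0] r by simp
      moreover have "Y t + r * a (lower (Y t) t) - t * a (lower (Y t) t) = Y r"
        using st[of r] r by (simp add: algebra_simps)
      ultimately show ?thesis by linarith
    qed
    then have "lower (Y t) t = u" using r by (simp add: a_eq_iff)
    then show ?thesis using st[of r] r by (simp add: algebra_simps)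
  qed
  have ev: "eventually (\<lambda>t. r < t \<and> t < t0) (at_left t0)"
    using r by (auto simp: eventually_at_left_field)
  have "((\<lambda>t. Y r + (t - r) * a u) \<longlongrightarrow> Y r + (t0 - r) * a u) (at_left t0)"
    by (intro tendsto_intros)
  moreover have "eventually (\<lambda>t. Y r + (t - r) * a u = Y t) (at_left t0)"
    using ev
  proof eventually_elim
    case (elim t)
    then show ?case using line[of t] by linarith
  qed
  ultimately have "(Y \<longlongrightarrow> Y r + (t0 - r) * a u) (at_left t0)"
    by (rule Lim_transform_eventually)
  from tendsto_unique[OF _ this gap_char_tendsto] have Yr: "Y r = x0 + (r - t0) * a u"
    by (simp add: algebra_simps)
  have "u \<in> U x0 t0"
  proof (rule U_closed_graph[OF _ gap_char_tendsto _ _ t0_pos])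
    show "eventually (\<lambda>t. u \<in> U (Y t) t) (at_left t0)"
      using ev
    proof eventually_elim
      case (elim t)
      then have "lower (Y t) t \<in> U (Y t) t" using lower_in_U r by simp
      moreover have "lower (Y t) t = u" using conjunct1[OF line[of t]] elim by simp
      ultimately show ?case by simp
    qed
  qed auto
  moreover have "c < u" "u < d"
    using gap_char_between[of r] r by (auto simp: Yr a_less_iff)
  ultimately show False using gap(3) by auto
qed

text \<open>A shock at time \<open>r\<close> splits the base points:
  \<open>bd \<le> bl < br \<le> bc\<close>. After \<open>r\<close>, base points from the left of
  \<open>Y\<close> inside the triangle lie in \<open>{bd..bl}\<close>, from the right in
  \<open>{br..bc}\<close>. Since \<open>{c<..<d}\<close> contains no minimizer, only
  \<open>d\<close> fits the first interval and only \<open>c\<close> the second.\<close>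

lemma gap_limits:
  shows "((\<lambda>(x, t). uleft f \<phi> x t) \<longlongrightarrow> d) (at (x0, t0) within Delta_J_minus f {c<..<d} x0 t0 th Y)"
    "((\<lambda>(x, t). uright f \<phi> x t) \<longlongrightarrow> d) (at (x0, t0) within Delta_J_minus f {c<..<d} x0 t0 th Y)"
    "((\<lambda>(x, t). uleft f \<phi> x t) \<longlongrightarrow> c) (at (x0, t0) within Delta_J_plus f {c<..<d} x0 t0 th Y)"
    "((\<lambda>(x, t). uright f \<phi> x t) \<longlongrightarrow> c) (at (x0, t0) within Delta_J_plus f {c<..<d} x0 t0 th Y)"
    "((\<lambda>t. uleft f \<phi> (Y t) t) \<longlongrightarrow> d) (at_left t0)"
    "((\<lambda>t. uright f \<phi> (Y t) t) \<longlongrightarrow> c) (at_left t0)"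
proof -
  obtain r where r: "tn < r" "r < t0" "lower (Y r) r < upper (Y r) r" using gap_char_shock by blast
  have r0: "0 < r" using r tn by simp
  define bc bd bl br where "bc = x0 - t0 * a c" and "bd = x0 - t0 * a d"
    and "bl = Y r - r * a (upper (Y r) r)" and "br = Y r - r * a (lower (Y r) r)"
  have "bl < br" using r(3) r0 by (simp add: bl_def br_def a_less_iff)
  moreover have "br \<le> bc"
    unfolding br_def bc_def
    by (rule no_cross[OF lower_in_U[OF r0] gap(1) r0]) (use gap_char_between(2)[of r] r in auto)
  moreover have "bd \<le> bl"
    unfolding bl_def bd_def
    by (rule no_cross[OF gap(2) upper_in_U[OF r0] r0]) (use gap_char_between(1)[of r] r in auto)
  ultimately have bs: "bl < bc" "bd < br" by auto
  have Yl: "Y t - t * a (upper (Y t) t) \<le> bl" and Yr: "br \<le> Y t - t * a (lower (Y t) t)"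
    if "r \<le> t" for t
    using fwd_char_base_mono[OF Y tn(1) _ that] r(1) by (auto simp: bl_def br_def)
  have right_of_d: "bd \<le> x - t * a v"
    if "x0 + (t - t0) * a d < x" "0 < t" "t < t0" "v \<in> U x t" for x t v
    using no_cross[OF gap(2) that(4) that(2)] that by (simp add: bd_def)
  have left_of_c: "x - t * a v \<le> bc"
    if "x < x0 + (t - t0) * a c" "0 < t" "t < t0" "v \<in> U x t" for x t v
    using no_cross[OF that(4) gap(1) that(2)] that by (simp add: bc_def)
  have uniq_d: "v = d" if v: "v \<in> U x0 t0" "x0 - t0 * a v \<in> {bd..bl}" for v
  proof -
    have "t0 * a v \<le> t0 * a d" "t0 * a c < t0 * a v" using v(2) bs by (auto simp: bd_def bc_def)
    then have "v \<le> d" "c < v" using t0_pos by (simp_all add: a_le_iff a_less_iff)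
    then show ?thesis using gap(3) v(1) by force
  qed
  have uniq_c: "v = c" if v: "v \<in> U x0 t0" "x0 - t0 * a v \<in> {br..bc}" for v
  proof -
    have "t0 * a c \<le> t0 * a v" "t0 * a v < t0 * a d" using v(2) bs by (auto simp: bd_def bc_def)
    then have "c \<le> v" "v < d" using t0_pos by (simp_all add: a_le_iff a_less_iff)
    then show ?thesis using gap(3) v(1) by force
  qed
  have wedge: "x0 + (t - t0) * a d < x" "x < x0 + (t - t0) * a c"
    if "(x, t) \<in> Delta f {c<..<d} x0 t0" for x t
    using that by (auto simp: Delta_def lseg_def a_less_iff)
  \<comment> \<open>Near \<open>(x0, t0)\<close> times exceed the shock time \<open>r\<close>, where
    \<open>Yl\<close> and \<open>Yr\<close> apply.\<close>
  have late: "eventually (\<lambda>p. r < snd p \<and> p \<in> S) (at (x0, t0) within S)" for S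
  proof (rule eventually_conj)
    show "eventually (\<lambda>p. r < snd p) (at (x0, t0) within S)"
      using order_tendstoD(1)[OF tendsto_snd_at r(2)] .
    show "eventually (\<lambda>p. p \<in> S) (at (x0, t0) within S)"
      unfolding eventually_at_filter by (intro always_eventually) auto
  qed
  have ev_minus: "eventually (\<lambda>p. \<forall>v\<in>U (fst p) (snd p). fst p - snd p * a v \<in> {bd..bl})
      (at (x0, t0) within Delta_J_minus f {c<..<d} x0 t0 th Y)"
    using late
  proof eventually_elim
    case (elim p)
    obtain x t where p: "p = (x, t)" by (cases p)
    have xt: "(x, t) \<in> Delta f {c<..<d} x0 t0" "x < Y t" "r < t" "t < t0" "0 < t"
      using elim p r0 by (auto simp: Delta_J_minus_def)
    have "x - t * a v \<le> bl" if "v \<in> U x t" for v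
      using no_cross[OF that upper_in_U[OF xt(5), of "Y t"] xt(5)] xt(2) Yl[of t] xt(3) by simp
    then show ?case using p right_of_d[OF wedge(1)[OF xt(1)] xt(5,4)] by auto
  qed
  have ev_plus: "eventually (\<lambda>p. \<forall>v\<in>U (fst p) (snd p). fst p - snd p * a v \<in> {br..bc})
      (at (x0, t0) within Delta_J_plus f {c<..<d} x0 t0 th Y)"
    using late
  proof eventually_elim
    case (elim p)
    obtain x t where p: "p = (x, t)" by (cases p)
    have xt: "(x, t) \<in> Delta f {c<..<d} x0 t0" "Y t < x" "r < t" "t < t0" "0 < t"
      using elim p r0 by (auto simp: Delta_J_plus_def)
    have "br \<le> x - t * a v" if "v \<in> U x t" for v
      using no_cross[OF lower_in_U[OF xt(5), of "Y t"] that xt(5)] xt(2) Yr[of t] xt(3) by simp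
    then show ?case using p left_of_c[OF wedge(2)[OF xt(1)] xt(5,4)] by auto
  qed
  show "((\<lambda>(x, t). uleft f \<phi> x t) \<longlongrightarrow> d) (at (x0, t0) within Delta_J_minus f {c<..<d} x0 t0 th Y)"
    "((\<lambda>(x, t). uright f \<phi> x t) \<longlongrightarrow> d) (at (x0, t0) within Delta_J_minus f {c<..<d} x0 t0 th Y)"
    using traces_tendsto[OF tendsto_fst_at tendsto_snd_at t0_pos closed_atLeastAtMost ev_minus uniq_d]
    by (simp_all add: split_def)
  show "((\<lambda>(x, t). uleft f \<phi> x t) \<longlongrightarrow> c) (at (x0, t0) within Delta_J_plus f {c<..<d} x0 t0 th Y)"
    "((\<lambda>(x, t). uright f \<phi> x t) \<longlongrightarrow> c) (at (x0, t0) within Delta_J_plus f {c<..<d} x0 t0 th Y)"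
    using traces_tendsto[OF tendsto_fst_at tendsto_snd_at t0_pos closed_atLeastAtMost ev_plus uniq_c]
    by (simp_all add: split_def)
  have ev: "eventually (\<lambda>t. r < t \<and> t < t0) (at_left t0)"
    using r by (auto simp: eventually_at_left_field)
  show "((\<lambda>t. uleft f \<phi> (Y t) t) \<longlongrightarrow> d) (at_left t0)"
  proof (rule minimizer_tendsto[OF gap_char_tendsto _ t0_pos _ closed_atLeastAtMost _ uniq_d])
    show "eventually (\<lambda>t. uleft f \<phi> (Y t) t \<in> U (Y t) t) (at_left t0)"
      using ev by eventually_elim (use r0 in \<open>auto simp: trace_eqs upper_in_U\<close>)
    show "eventually (\<lambda>t. Y t - t * a (uleft f \<phi> (Y t) t) \<in> {bd..bl}) (at_left t0)"
      using ev
    proof eventually_elim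
      case (elim t)
      then have t: "0 < t" "tn \<le> t" using r0 r by auto
      show ?case
        using right_of_d[OF gap_char_between(1)[OF t(2)] t(1) _ upper_in_U[OF t(1)]] Yl[of t] elim t
        by (simp add: trace_eqs)
    qed
  qed auto
  show "((\<lambda>t. uright f \<phi> (Y t) t) \<longlongrightarrow> c) (at_left t0)"
  proof (rule minimizer_tendsto[OF gap_char_tendsto _ t0_pos _ closed_atLeastAtMost _ uniq_c])
    show "eventually (\<lambda>t. uright f \<phi> (Y t) t \<in> U (Y t) t) (at_left t0)"
      using ev by eventually_elim (use r0 in \<open>auto simp: trace_eqs lower_in_U\<close>)
    show "eventually (\<lambda>t. Y t - t * a (uright f \<phi> (Y t) t) \<in> {br..bc}) (at_left t0)"
      using ev
    proof eventually_elim
      case (elim t)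
      then have t: "0 < t" "tn \<le> t" using r0 r by auto
      show ?case
        using left_of_c[OF gap_char_between(2)[OF t(2)] t(1) _ lower_in_U[OF t(1)]] Yr[of t] elim t
        by (simp add: trace_eqs)
    qed
  qed auto
qed

end

end

section \<open>Reduction of the maximization to the Hopf--Lax problem\<close>

text \<open>The primitive vanishing at \<open>0\<close>. At most one term is nonzero, since an
  interval with reversed endpoints is empty.\<close>

definition oriented_integral :: "(real \<Rightarrow> real) \<Rightarrow> real \<Rightarrow> real" where
  "oriented_integral g y = integral {0..y} g - integral {y..0} g"

lemma oriented_integral_diff:
  assumes g: "\<And>p q. g integrable_on {p..q}" and pq: "p \<le> q"
  shows "oriented_integral g q - oriented_integral g p = integral {p..q} g"
proof -
  have comb: "integral {p..r} g + integral {r..q} g = integral {p..q} g" if "p \<le> r" "r \<le> q" for p r q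
    using Henstock_Kurzweil_Integration.integral_combine[OF that g] .
  have pos: "oriented_integral g y = integral {0..y} g" if "0 \<le> y" for y
    using that by (cases "y = 0") (auto simp: oriented_integral_def)
  have neg: "oriented_integral g y = - integral {y..0} g" if "y \<le> 0" for y
    using that by (cases "y = 0") (auto simp: oriented_integral_def)
  consider "0 \<le> p" | "p \<le> 0" "0 \<le> q" | "q \<le> 0" by linarith
  then show ?thesis
  proof cases
    case 1
    then show ?thesis using comb[of 0 p q] pq pos by simp
  next
    case 2
    then show ?thesis using comb[of p 0 q] pos neg by simp
  next
    case 3
    then show ?thesis using comb[of p q 0] pq neg by simp
  qed
qed

text \<open>Passes from the Lebesgue integral over open intervals in \<open>Efun\<close> to gauge
  integrals over closed ones, to which substitution and the fundamental theorem are applied.\<close>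

lemma interval_integral_eq_oriented_integral:
  assumes g: "\<And>p q. g absolutely_integrable_on {p..q}"
  shows "interval_lebesgue_integral lebesgue 0 (ereal u) g = oriented_integral g u"
proof -
  have Ioo: "(LINT x:{p<..<q}|lebesgue. g x) = integral {p..q} g" for p q :: real
  proof -
    have "g absolutely_integrable_on {p<..<q}"
      by (rule set_integrable_subset[OF g[of p q]]) auto
    then show ?thesis
      using set_lebesgue_integral_eq_integral(2) by (metis integral_open_interval_real)
  qed
  show ?thesis
  proof (cases "0 \<le> u")
    case True
    then have "integral {u..0} g = 0" by (cases "u = 0") auto
    then show ?thesis using True Ioo[of 0 u]
      by (simp add: interval_lebesgue_integral_def oriented_integral_def zero_ereal_def)
  next
    case False
    then show ?thesis using Ioo[of u 0]
      by (simp add: interval_lebesgue_integral_def oriented_integral_def zero_ereal_def)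
  qed
qed

text \<open>Truncation at \<open>\<bar>M\<bar>\<close> changes \<open>\<phi>\<close> only on a
  negligible set and makes it bounded everywhere, so integrability and the bound transfer
  back.\<close>

lemma Linfty_integral_bound:
  assumes "Linfty \<phi>"
  obtains M where "\<And>p q. \<phi> absolutely_integrable_on {p..q}"
    "\<And>p q. p \<le> q \<Longrightarrow> \<bar>integral {p..q} \<phi>\<bar> \<le> M * (q - p)"
proof -
  obtain M where meas: "\<phi> \<in> borel_measurable lebesgue" and AE: "AE x in lebesgue. \<bar>\<phi> x\<bar> \<le> M"
    using assms by (auto simp: Linfty_def)
  obtain N where N: "N \<in> null_sets lebesgue" "{x. \<not> \<bar>\<phi> x\<bar> \<le> M} \<subseteq> N"
    using AE unfolding eventually_ae_filter by auto
  define N' where "N' = {x. \<not> \<bar>\<phi> x\<bar> \<le> M}"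
  have neg: "negligible N'"
    using N negligible_iff_null_sets negligible_subset unfolding N'_def by blast
  define \<psi> where "\<psi> x = max (- \<bar>M\<bar>) (min \<bar>M\<bar> (\<phi> x))" for x
  have \<psi>_eq: "\<psi> x = \<phi> x" if "x \<notin> N'" for x using that by (auto simp: N'_def \<psi>_def)
  have \<psi>_meas: "\<psi> \<in> borel_measurable (lebesgue_on {p..q})" for p q
    unfolding \<psi>_def by (intro measurable_restrict_space1) (use meas in measurable)
  have \<psi>_bound: "norm (\<psi> x) \<le> \<bar>M\<bar>" for x by (auto simp: \<psi>_def)
  have \<psi>_int: "\<psi> absolutely_integrable_on {p..q}" for p q
    by (rule measurable_bounded_by_integrable_imp_absolutely_integrable[OF \<psi>_meas _ _ \<psi>_bound])
      (auto intro: integrable_continuous_real)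
  have "\<phi> absolutely_integrable_on {p..q}" for p q
    by (rule absolutely_integrable_spike[OF \<psi>_int neg]) (use \<psi>_eq in auto)
  moreover have "\<bar>integral {p..q} \<phi>\<bar> \<le> \<bar>M\<bar> * (q - p)" if "p \<le> q" for p q
  proof -
    have "integral {p..q} \<phi> = integral {p..q} \<psi>"
      by (rule integral_spike[OF neg]) (use \<psi>_eq in auto)
    moreover have "norm (integral {p..q} \<psi>) \<le> integral {p..q} (\<lambda>_. \<bar>M\<bar>)"
      by (rule Henstock_Kurzweil_Integration.integral_norm_bound_integral[OF _ _ \<psi>_bound])
        (use \<psi>_int set_lebesgue_integral_eq_integral(1) in \<open>auto intro: integrable_continuous_real\<close>)
    ultimately show ?thesis using that by (simp add: mult.commute)
  qed
  ultimately show ?thesis using that by blast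
qed

text \<open>A nondecreasing function that is not strictly increasing is constant on some interval;
  its derivative vanishes there, on a set of positive measure.\<close>

lemma strict_mono_of_deriv_nonneg:
  fixes g g' :: "real \<Rightarrow> real"
  assumes der: "\<And>u. (g has_real_derivative g' u) (at u)" and nn: "\<And>u. 0 \<le> g' u"
    and null: "{u. g' u = 0} \<in> null_sets lebesgue"
  shows "strict_mono g"
proof (rule strict_monoI)
  fix u v :: real assume uv: "u < v"
  show "g u < g v"
  proof (rule ccontr)
    assume "\<not> g u < g v"
    have mono: "g p \<le> g q" if "p \<le> q" for p q
      using DERIV_nonneg_imp_nondecreasing[OF that] der nn by blast
    then have "g u = g v" using mono[OF less_imp_le[OF uv]] \<open>\<not> g u < g v\<close> by linarith
    then have const: "g z = g u" if "z \<in> {u<..<v}" for z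
      using mono[of u z] mono[of z v] that by auto
    have "g' z = 0" if z: "z \<in> {u<..<v}" for z
    proof -
      have "((\<lambda>_. g u) has_real_derivative g' z) (at z)"
        by (rule DERIV_cong_ev[THEN iffD1, OF refl _ refl der])
          (use const z in \<open>auto simp: eventually_nhds intro!: exI[of _ "{u<..<v}"]\<close>)
      then show ?thesis using DERIV_unique DERIV_const by blast
    qed
    then have "{u<..<v} \<subseteq> {u. g' u = 0}" by auto
    then have "negligible {u<..<v}" using null negligible_iff_null_sets negligible_subset by blast
    then have "box u v = {}" using negligible_interval(2)[of u v] by simp
    then show False using uv by simp
  qed
qed

text \<open>Substituting \<open>y = x - t * deriv f s\<close> integrates the \<open>\<phi>\<close>
  part of \<open>Efun\<close>, and \<open>s * f''(s)\<close> has primitive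
  \<open>s * f'(s) - f(s)\<close>. Hence \<open>Efun\<close> plus the cost is constant in the state,
  and maximizing one is minimizing the other.\<close>

lemma Efun_hopf_lax:
  fixes f \<phi> :: "real \<Rightarrow> real"
  assumes C2: "C2 f" and nn: "\<And>u. 0 \<le> deriv (deriv f) u" and mono: "strict_mono (deriv f)"
    and \<phi>: "\<And>p q. \<phi> absolutely_integrable_on {p..q}" and t: "0 < t"
  shows "Efun f \<phi> u x t
      + (oriented_integral \<phi> (x - t * deriv f u) + t * (u * deriv f u - f u))
    = Efun f \<phi> v x t
      + (oriented_integral \<phi> (x - t * deriv f v) + t * (v * deriv f v - f v))"
proof -
  define a where "a = deriv f"
  define a' where "a' = deriv a"
  define G where "G s = a' s * (\<phi> (x - t * a s) - s)" for s
  define h where "h s = s * a s - f s" for s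
  have f': "(f has_real_derivative a s) (at s)" and a': "(a has_real_derivative a' s) (at s)"
    and a'_cont: "continuous_on UNIV a'" for s
    using C2 by (auto simp: C2_def a_def a'_def DERIV_deriv_iff_field_differentiable)
  have inj: "inj_on (\<lambda>s. x - t * a s) S" for S
    using mono t by (auto simp: inj_on_def a_def strict_mono_eq)
  have a_cont: "continuous_on S a" for S
    using a' by (meson DERIV_isCont continuous_at_imp_continuous_on)
  have image: "(\<lambda>s. x - t * a s) ` {p..q} = {x - t * a q..x - t * a p}" if pq: "p \<le> q" for p q
  proof
    show "(\<lambda>s. x - t * a s) ` {p..q} \<subseteq> {x - t * a q..x - t * a p}"
      using mono t by (auto simp: a_def strict_mono_less_eq)
    show "{x - t * a q..x - t * a p} \<subseteq> (\<lambda>s. x - t * a s) ` {p..q}"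
    proof
      fix y assume y: "y \<in> {x - t * a q..x - t * a p}"
      have "\<exists>s. p \<le> s \<and> s \<le> q \<and> x - t * a s = y"
        by (rule IVT2') (use y pq in \<open>auto intro!: continuous_intros a_cont\<close>)
      then show "y \<in> (\<lambda>s. x - t * a s) ` {p..q}" by auto
    qed
  qed
  \<comment> \<open>The substitution reverses orientation: the endpoints swap and the absolute value
    of a nonpositive derivative appears, which \<open>tabs\<close> resolves.\<close>
  have subst: "(\<lambda>s. \<bar>- (t * a' s)\<bar> * \<phi> (x - t * a s)) absolutely_integrable_on {p..q} \<and>
      integral {p..q} (\<lambda>s. \<bar>- (t * a' s)\<bar> * \<phi> (x - t * a s))
        = integral {x - t * a q..x - t * a p} \<phi>" if pq: "p \<le> q" for p q
  proof (rule has_absolute_integral_change_of_variables_1'[where g = "\<lambda>s. x - t * a s"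
        and g' = "\<lambda>s. - (t * a' s)" and f = \<phi>, THEN iffD2])
    show "((\<lambda>s. x - t * a s) has_real_derivative - (t * a' s)) (at s within {p..q})" for s
      by (auto intro!: derivative_eq_intros has_field_derivative_at_within[OF a'])
    show "\<phi> absolutely_integrable_on (\<lambda>s. x - t * a s) ` {p..q} \<and>
        integral ((\<lambda>s. x - t * a s) ` {p..q}) \<phi> = integral {x - t * a q..x - t * a p} \<phi>"
      unfolding image[OF pq] using \<phi> by simp
  qed (use inj in auto)
  have tabs: "\<bar>- (t * a' s)\<bar> = t * a' s" for s using t nn[of s] by (simp add: a'_def a_def)
  have A1: "(\<lambda>s. a' s * \<phi> (x - t * a s)) absolutely_integrable_on {p..q}"
    and I1: "p \<le> q \<Longrightarrow> t * integral {p..q} (\<lambda>s. a' s * \<phi> (x - t * a s))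
      = integral {x - t * a q..x - t * a p} \<phi>" for p q
  proof -
    show "(\<lambda>s. a' s * \<phi> (x - t * a s)) absolutely_integrable_on {p..q}"
    proof (cases "p \<le> q")
      case True
      then have "(\<lambda>s. (1 / t) * (t * a' s * \<phi> (x - t * a s))) absolutely_integrable_on {p..q}"
        using subst[OF True, unfolded tabs] by (intro set_integrable_mult_right) simp
      then show ?thesis using t by simp
    qed simp
    show "p \<le> q \<Longrightarrow> t * integral {p..q} (\<lambda>s. a' s * \<phi> (x - t * a s))
      = integral {x - t * a q..x - t * a p} \<phi>"
      using subst[of p q, unfolded tabs] by (simp add: mult.assoc)
  qed
  have A2: "(\<lambda>s. s * a' s) absolutely_integrable_on {p..q}" for p q
    by (intro absolutely_integrable_continuous_real continuous_intros
        continuous_on_subset[OF a'_cont]) auto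
  have I2: "integral {p..q} (\<lambda>s. s * a' s) = h q - h p" if "p \<le> q" for p q
  proof (rule integral_unique, rule fundamental_theorem_of_calculus[OF that])
    fix s
    have "(h has_real_derivative s * a' s) (at s)"
      unfolding h_def by (auto intro!: derivative_eq_intros f' a')
    then show "(h has_vector_derivative s * a' s) (at s within {p..q})"
      by (simp add: has_real_derivative_iff_has_vector_derivative has_vector_derivative_at_within)
  qed
  have G: "G = (\<lambda>s. a' s * \<phi> (x - t * a s) - s * a' s)" by (auto simp: G_def algebra_simps)
  have AG: "G absolutely_integrable_on {p..q}" for p q
    unfolding G by (intro set_integral_diff(1) A1 A2)
  note int = set_lebesgue_integral_eq_integral(1)
  have E: "Efun f \<phi> s x t = t * oriented_integral G s" for s
    unfolding Efun_def interval_integral_eq_oriented_integral[OF AG, symmetric]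
    by (simp add: G_def[abs_def] a'_def a_def)
  have step: "Efun f \<phi> q x t + (oriented_integral \<phi> (x - t * a q) + t * h q)
      = Efun f \<phi> p x t + (oriented_integral \<phi> (x - t * a p) + t * h p)" if pq: "p \<le> q" for p q
  proof -
    have "Efun f \<phi> q x t - Efun f \<phi> p x t = t * integral {p..q} G"
      using oriented_integral_diff[OF int[OF AG] pq] by (simp add: E flip: right_diff_distrib)
    also have "\<dots> = t * integral {p..q} (\<lambda>s. a' s * \<phi> (x - t * a s)) - t * (h q - h p)"
      unfolding G using integral_diff[OF int[OF A1] int[OF A2], of p q] I2[OF pq]
      by (simp add: right_diff_distrib)
    also have "\<dots> = integral {x - t * a q..x - t * a p} \<phi> - t * (h q - h p)"
      using I1[OF pq] by simp
    also have "integral {x - t * a q..x - t * a p} \<phi>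
        = oriented_integral \<phi> (x - t * a p) - oriented_integral \<phi> (x - t * a q)"
      using pq mono t by (subst oriented_integral_diff[OF int[OF \<phi>]]) (auto simp: a_def strict_mono_less_eq)
    finally show ?thesis by (simp add: algebra_simps)
  qed
  show ?thesis
    using step[of u v] step[of v u] by (cases "u \<le> v") (auto simp: a_def h_def)
qed

lemma hopf_lax_of_assumptions:
  assumes C2: "C2 f" and nn: "\<forall>u. 0 \<le> deriv (deriv f) u"
    and null: "{u. deriv (deriv f) u = 0} \<in> null_sets lebesgue" and \<phi>: "Linfty \<phi>"
  obtains \<Phi> M where "hopf_lax f \<phi> \<Phi> M"
proof -
  obtain M where int: "\<And>p q. \<phi> absolutely_integrable_on {p..q}"
    and M: "\<And>p q. p \<le> q \<Longrightarrow> \<bar>integral {p..q} \<phi>\<bar> \<le> M * (q - p)"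
    using Linfty_integral_bound[OF \<phi>] by blast
  have a': "(deriv f has_real_derivative deriv (deriv f) u) (at u)" for u
    using C2 by (auto simp: C2_def DERIV_deriv_iff_field_differentiable)
  have mono: "strict_mono (deriv f)"
    using strict_mono_of_deriv_nonneg[OF a' _ null] nn by blast
  have "hopf_lax f \<phi> (oriented_integral \<phi>) M"
  proof
    show "continuous_on UNIV (deriv f)"
      using a' by (meson DERIV_isCont continuous_at_imp_continuous_on)
    show "f field_differentiable (at u)" for u using C2 by (simp add: C2_def)
    show "\<bar>oriented_integral \<phi> x - oriented_integral \<phi> y\<bar> \<le> M * \<bar>x - y\<bar>" for x y
    proof (cases "x \<le> y")
      case True
      then show ?thesis using M[OF True]
          oriented_integral_diff[OF set_lebesgue_integral_eq_integral(1)[OF int] True] by simp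
    next
      case False
      then have "y \<le> x" by simp
      then show ?thesis using M[of y x]
          oriented_integral_diff[OF set_lebesgue_integral_eq_integral(1)[OF int] \<open>y \<le> x\<close>] by simp
    qed
    fix u x t :: real assume t: "0 < t"
    note eq = Efun_hopf_lax[OF C2 spec[OF nn] mono int t, of u x]
    show "u \<in> Umax f \<phi> x t \<longleftrightarrow>
      (\<forall>v. oriented_integral \<phi> (x - t * deriv f u) + t * (u * deriv f u - f u)
         \<le> oriented_integral \<phi> (x - t * deriv f v) + t * (v * deriv f v - f v))"
      unfolding Umax_def mem_Collect_eq
    proof (intro arg_cong[where f = All] ext)
      fix v
      show "Efun f \<phi> v x t \<le> Efun f \<phi> u x t \<longleftrightarrow>
        oriented_integral \<phi> (x - t * deriv f u) + t * (u * deriv f u - f u)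
         \<le> oriented_integral \<phi> (x - t * deriv f v) + t * (v * deriv f v - f v)"
        using eq[of v] by linarith
    qed
  qed (rule mono)
  then show ?thesis using that by blast
qed

theorem theorem5p4:
  fixes f \<phi> :: "real \<Rightarrow> real" and x0 t0 :: real
  assumes "C2 f"
    and "\<forall>u. 0 \<le> deriv (deriv f) u"
    and "{u. deriv (deriv f) u = 0} \<in> null_sets lebesgue"
    and "Linfty \<phi>"
    and "0 < t0"
    and "uright f \<phi> x0 t0 < uleft f \<phi> x0 t0"
  shows
    "(\<forall>X. fwd_char f \<phi> x0 t0 X \<longrightarrow>
        ((\<lambda>(x, t). uleft f \<phi> x t) \<longlongrightarrow> uleft f \<phi> x0 t0)
          (at (x0, t0) within Delta_minus f \<phi> x0 t0 X) \<and>
        ((\<lambda>(x, t). uright f \<phi> x t) \<longlongrightarrow> uleft f \<phi> x0 t0)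
          (at (x0, t0) within Delta_minus f \<phi> x0 t0 X) \<and>
        ((\<lambda>(x, t). uleft f \<phi> x t) \<longlongrightarrow> uright f \<phi> x0 t0)
          (at (x0, t0) within Delta_plus f \<phi> x0 t0 X) \<and>
        ((\<lambda>(x, t). uright f \<phi> x t) \<longlongrightarrow> uright f \<phi> x0 t0)
          (at (x0, t0) within Delta_plus f \<phi> x0 t0 X) \<and>
        ((\<lambda>t. uleft f \<phi> (X t) t) \<longlongrightarrow> uleft f \<phi> x0 t0) (at_right t0) \<and>
        ((\<lambda>t. uright f \<phi> (X t) t) \<longlongrightarrow> uright f \<phi> x0 t0) (at_right t0))
     \<and>
     (\<forall>c d. {c<..<d} \<in> components (Ucompl f \<phi> x0 t0) \<longrightarrow>
        (\<forall>xn tn Y. (xn, tn) \<in> Delta f {c<..<d} x0 t0 \<and> fwd_char f \<phi> xn tn Y \<longrightarrow>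
           (\<forall>th. tn < th \<and> th < t0 \<and> shock_from f \<phi> Y th t0 \<longrightarrow>
              ((\<lambda>(x, t). uleft f \<phi> x t) \<longlongrightarrow> d)
                (at (x0, t0) within Delta_J_minus f {c<..<d} x0 t0 th Y) \<and>
              ((\<lambda>(x, t). uright f \<phi> x t) \<longlongrightarrow> d)
                (at (x0, t0) within Delta_J_minus f {c<..<d} x0 t0 th Y) \<and>
              ((\<lambda>(x, t). uleft f \<phi> x t) \<longlongrightarrow> c)
                (at (x0, t0) within Delta_J_plus f {c<..<d} x0 t0 th Y) \<and>
              ((\<lambda>(x, t). uright f \<phi> x t) \<longlongrightarrow> c)
                (at (x0, t0) within Delta_J_plus f {c<..<d} x0 t0 th Y)) \<and>
           ((\<lambda>t. uleft f \<phi> (Y t) t) \<longlongrightarrow> d) (at_left t0) \<and>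
           ((\<lambda>t. uright f \<phi> (Y t) t) \<longlongrightarrow> c) (at_left t0)))"
proof -
  obtain \<Phi> M where "hopf_lax f \<phi> \<Phi> M"
    using hopf_lax_of_assumptions[OF assms(1-4)] by blast
  then interpret hopf_lax f \<phi> \<Phi> M .
  have gap:
    "((\<lambda>(x, t). uleft f \<phi> x t) \<longlongrightarrow> d) (at (x0, t0) within Delta_J_minus f {c<..<d} x0 t0 th Y)"
    "((\<lambda>(x, t). uright f \<phi> x t) \<longlongrightarrow> d) (at (x0, t0) within Delta_J_minus f {c<..<d} x0 t0 th Y)"
    "((\<lambda>(x, t). uleft f \<phi> x t) \<longlongrightarrow> c) (at (x0, t0) within Delta_J_plus f {c<..<d} x0 t0 th Y)"
    "((\<lambda>(x, t). uright f \<phi> x t) \<longlongrightarrow> c) (at (x0, t0) within Delta_J_plus f {c<..<d} x0 t0 th Y)"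
    "((\<lambda>t. uleft f \<phi> (Y t) t) \<longlongrightarrow> d) (at_left t0)"
    "((\<lambda>t. uright f \<phi> (Y t) t) \<longlongrightarrow> c) (at_left t0)"
    if C: "{c<..<d} \<in> components (Ucompl f \<phi> x0 t0)"
      and n: "(xn, tn) \<in> Delta f {c<..<d} x0 t0" and Y: "fwd_char f \<phi> xn tn Y"
    for c d xn tn Y th
  proof -
    \<comment> \<open>The ends of a component are minimizers, which makes it a gap as in
      \<open>gap_limits\<close>; \<open>w\<close> is the state whose backward line from
      \<open>(x0, t0)\<close> passes through \<open>(xn, tn)\<close>.\<close>
    note ends = component_of_complement_endpoints[OF C[unfolded Ucompl_def Iset_def]]
    obtain w where w: "c < w" "w < d" and xn: "xn = x0 + (tn - t0) * deriv f w"
      and tn: "0 < tn" "tn < t0"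
      using n by (auto simp: Delta_def lseg_def)
    note L = gap_limits[OF ends(2-4) w tn Y[unfolded xn]]
    show "((\<lambda>(x, t). uleft f \<phi> x t) \<longlongrightarrow> d) (at (x0, t0) within Delta_J_minus f {c<..<d} x0 t0 th Y)"
      "((\<lambda>(x, t). uright f \<phi> x t) \<longlongrightarrow> d) (at (x0, t0) within Delta_J_minus f {c<..<d} x0 t0 th Y)"
      "((\<lambda>(x, t). uleft f \<phi> x t) \<longlongrightarrow> c) (at (x0, t0) within Delta_J_plus f {c<..<d} x0 t0 th Y)"
      "((\<lambda>(x, t). uright f \<phi> x t) \<longlongrightarrow> c) (at (x0, t0) within Delta_J_plus f {c<..<d} x0 t0 th Y)"
      "((\<lambda>t. uleft f \<phi> (Y t) t) \<longlongrightarrow> d) (at_left t0)"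
      "((\<lambda>t. uright f \<phi> (Y t) t) \<longlongrightarrow> c) (at_left t0)"
      by (rule L)+
  qed
  show ?thesis
    by (intro conjI allI impI; (elim conjE)?;
        rule limits_left_of_char[OF assms(5)] limits_right_of_char[OF assms(5)] gap; assumption)
qed

end
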